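(* Let $m\ge1$ and $r\ge2$ be integers, $B\subset\mathbb C^m$ the open Euclidean unit ball, $V$ a complex vector space of dimension $r$, and $F=B\times V\to B$ the trivial vector bundle. Given positively curved metrics $\mathsf k_1,\mathsf k_2,\mathsf k_3$ on $O_{\mathbb P V}(1)$ such that $\mathsf k_1>\mathsf k_2>\mathsf k_3$ away from the zero section, there are positive numbers $r_1<r_2<r_3<1$ and a positively curved metric $k$ on $O_{\mathbb P F}(1)$ such that for any $j=1,2,3$ \[ k|O_{\mathbb P F_s}(1)=\mathsf k_j\qquad\text{if } s\in B,\ \|s\|=r_j. \] Moreover, if $\|s\|$ is sufficiently close to $r_j$, then $k|O_{\mathbb P F_s}(1)=c_s\mathsf k_j$ with a constant $c_s>0$ (depending on $s$).
   Context: **Metrics and curvature.** A hermitian metric on a finite dimensional complex vector space is a function of the form $v\mapsto\hat h(v,v)$, with $\hat h$ a positive definite hermitian form. A (hermitian) metric on a holomorphic vector bundle $E\to S$ is a function $h:E\to\mathbb R$ on the total space whose restriction to each fiber is a hermitian metric in this sense; it is smooth if $h$ is $C^\infty$. The metric $h$ is negatively curved if $h$ is smooth and strongly plurisubharmonic ($i\partial\bar\partial h>0$) on the total space away from the zero section. The metric $h$ is positively curved if the dual metric $h^*$ on the dual bundle $E^*$ is negatively curved. **The bundle $O_{\mathbb P E}(1)$.** For a holomorphic vector bundle $E\to S$, $\mathbb P E=\coprod_{s\in S}\mathbb P E_s$ is the set of hyperplanes (linear subspaces of codimension one) $P\subset E_s$ in the fibers of $E$, with its natural complex manifold structure and projection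 $\pi:\mathbb P E\to S$. Then $O_{\mathbb P E}(1)\to \mathbb P E$ is the holomorphic line bundle $(\pi^*E)/H$, where $H\subset\pi^*E$ is the tautological subbundle whose fiber over $P\in\mathbb P E_s$ is $P$; so its fiber over $P\in\mathbb P E_s$ is $E_s/P$. For a vector space $V$ (the case when $S$ is a point) this gives $O_{\mathbb P V}(1)\to\mathbb P V$. **Identification.** $F_s=\{s\}\times V$ is identified with $V$, and so $O_{\mathbb P F_s}(1)$ with $O_{\mathbb P V}(1)$. $\|\ \|$ is the Euclidean norm on $\mathbb C^m$. *)

theory Defs
  imports "HOL-Analysis.Analysis"
begin

section \<open>Smooth and strongly plurisubharmonic functions on open sets of complex coordinate space\<close>

text \<open>
  On an open subset of a finite dimensional space, \<open>higher_differentiable_on U f n\<close> means that the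
  iterated directional derivatives of order less than \<open>n\<close> are differentiable and those of order \<open>n\<close>
  are continuous, i.e. that \<open>f\<close> is of class \<open>C\<^sup>n\<close>.
\<close>

fun higher_differentiable_on ::
    "'a::real_normed_vector set \<Rightarrow> ('a \<Rightarrow> 'b::real_normed_vector) \<Rightarrow> nat \<Rightarrow> bool" where
  "higher_differentiable_on U f 0 \<longleftrightarrow> continuous_on U f"
| "higher_differentiable_on U f (Suc n) \<longleftrightarrow>
     (\<forall>x\<in>U. f differentiable (at x)) \<and>
     (\<forall>v. higher_differentiable_on U (\<lambda>x. frechet_derivative f (at x) v) n)"

definition smooth_on :: "'a::real_normed_vector set \<Rightarrow> ('a \<Rightarrow> 'b::real_normed_vector) \<Rightarrow> bool" where
  "smooth_on U f \<longleftrightarrow> (\<forall>n. higher_differentiable_on U f n)"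

text \<open>The Wirtinger derivatives \<open>\<partial>f/\<partial>z\<^sub>j = (\<partial>f/\<partial>x\<^sub>j - i \<partial>f/\<partial>y\<^sub>j)/2\<close> and
  \<open>\<partial>f/\<partial>\<bar>z\<^sub>j = (\<partial>f/\<partial>x\<^sub>j + i \<partial>f/\<partial>y\<^sub>j)/2\<close>.\<close>

definition wirtinger :: "'n::finite \<Rightarrow> (complex^'n \<Rightarrow> complex) \<Rightarrow> complex^'n \<Rightarrow> complex" where
  "wirtinger j f z =
     (frechet_derivative f (at z) (axis j 1) - \<i> * frechet_derivative f (at z) (axis j \<i>)) / 2"

definition wirtinger_bar :: "'n::finite \<Rightarrow> (complex^'n \<Rightarrow> complex) \<Rightarrow> complex^'n \<Rightarrow> complex" where
  "wirtinger_bar j f z =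
     (frechet_derivative f (at z) (axis j 1) + \<i> * frechet_derivative f (at z) (axis j \<i>)) / 2"

text \<open>The condition \<open>i\<partial>\<partial>\<bar>f > 0\<close> at \<open>z\<close>: the complex Hessian
  \<open>(\<partial>\<^sup>2f/\<partial>z\<^sub>j\<partial>\<bar>z\<^sub>k)\<close> is positive definite. For \<open>C\<^sup>2\<close> real-valued \<open>f\<close> this matrix is hermitian, so
  the sum below is real.\<close>

definition levi_form :: "(complex^'n::finite \<Rightarrow> real) \<Rightarrow> complex^'n \<Rightarrow> complex^'n \<Rightarrow> complex" where
  "levi_form f z w =
     (\<Sum>j\<in>UNIV. \<Sum>k\<in>UNIV.
        wirtinger j (wirtinger_bar k (\<lambda>y. complex_of_real (f y))) z * w $ j * cnj (w $ k))"

definition strongly_psh_at :: "(complex^'n::finite \<Rightarrow> real) \<Rightarrow> complex^'n \<Rightarrow> bool" where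
  "strongly_psh_at f z \<longleftrightarrow> (\<forall>w. w \<noteq> 0 \<longrightarrow> Re (levi_form f z w) > 0)"


section \<open>Holomorphic vector bundles and their metrics\<close>

text \<open>
  A holomorphic vector bundle of rank \<open>CARD('k)\<close> over a base of dimension \<open>CARD('d)\<close> is given by its
  base, the vector space structure of its fibres, and its local trivializations. A trivialization
  \<open>(U, x, \<tau>)\<close> consists of an open set \<open>U\<close>, a holomorphic parametrization \<open>x\<close> of an open subset of the
  base by \<open>U\<close>, and, for \<open>z \<in> U\<close>, a linear isomorphism \<open>\<tau> z\<close> of \<open>\<complex>\<^sup>k\<close> onto the fibre over \<open>x z\<close>, depending
  holomorphically on \<open>z\<close>. The record itself imposes no laws; it is used for the concrete bundles below.
  The points of the total space are the pairs of a base point and an element of the fibre over it.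
\<close>

record ('p, 'e, 'd::finite, 'k::finite) hol_bundle =
  base :: "'p set"
  fibre :: "'p \<Rightarrow> 'e set"
  fzero :: "'p \<Rightarrow> 'e"
  fadd :: "'p \<Rightarrow> 'e \<Rightarrow> 'e \<Rightarrow> 'e"
  fscale :: "'p \<Rightarrow> complex \<Rightarrow> 'e \<Rightarrow> 'e"
  trivs :: "((complex^'d) set \<times> (complex^'d \<Rightarrow> 'p) \<times> (complex^'d \<Rightarrow> complex^'k \<Rightarrow> 'e)) set"

text \<open>The splitting of \<open>\<complex>\<^sup>a\<^sup>+\<^sup>b\<close> as \<open>\<complex>\<^sup>a \<times> \<complex>\<^sup>b\<close>.\<close>

definition coords1 :: "complex^('a::finite + 'b::finite) \<Rightarrow> complex^'a" where
  "coords1 v = (\<chi> i. v $ Inl i)"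

definition coords2 :: "complex^('a::finite + 'b::finite) \<Rightarrow> complex^'b" where
  "coords2 v = (\<chi> i. v $ Inr i)"

definition total_param ::
    "(complex^'d::finite \<Rightarrow> 'p) \<Rightarrow> (complex^'d \<Rightarrow> complex^'k::finite \<Rightarrow> 'e) \<Rightarrow> complex^('d + 'k) \<Rightarrow> 'p \<times> 'e"
  where "total_param x \<tau> v = (x (coords1 v), \<tau> (coords1 v) (coords2 v))"

definition hermitian_form_on ::
    "('p, 'e, 'd::finite, 'k::finite) hol_bundle \<Rightarrow> 'p \<Rightarrow> ('e \<Rightarrow> 'e \<Rightarrow> complex) \<Rightarrow> bool" where
  "hermitian_form_on E p H \<longleftrightarrow>
     (\<forall>x\<in>fibre E p. \<forall>y\<in>fibre E p. \<forall>z\<in>fibre E p. H (fadd E p x y) z = H x z + H y z) \<and>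
     (\<forall>c. \<forall>x\<in>fibre E p. \<forall>y\<in>fibre E p. H (fscale E p c x) y = c * H x y) \<and>
     (\<forall>x\<in>fibre E p. \<forall>y\<in>fibre E p. H y x = cnj (H x y))"

definition pos_def_on ::
    "('p, 'e, 'd::finite, 'k::finite) hol_bundle \<Rightarrow> 'p \<Rightarrow> ('e \<Rightarrow> 'e \<Rightarrow> complex) \<Rightarrow> bool" where
  "pos_def_on E p H \<longleftrightarrow> (\<forall>x\<in>fibre E p. x \<noteq> fzero E p \<longrightarrow> Re (H x x) > 0)"

definition is_metric :: "('p, 'e, 'd::finite, 'k::finite) hol_bundle \<Rightarrow> ('p \<times> 'e \<Rightarrow> real) \<Rightarrow> bool" where
  "is_metric E h \<longleftrightarrow>
     (\<forall>p\<in>base E. \<exists>H. hermitian_form_on E p H \<and> pos_def_on E p H \<and>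
        (\<forall>x\<in>fibre E p. complex_of_real (h (p, x)) = H x x))"

definition smooth_on_total ::
    "('p, 'e, 'd::finite, 'k::finite) hol_bundle \<Rightarrow> ('p \<times> 'e \<Rightarrow> real) \<Rightarrow> bool" where
  "smooth_on_total E h \<longleftrightarrow>
     (\<forall>(U, x, \<tau>)\<in>trivs E. smooth_on {v. coords1 v \<in> U} (\<lambda>v. h (total_param x \<tau> v)))"

definition strongly_psh_off_zero ::
    "('p, 'e, 'd::finite, 'k::finite) hol_bundle \<Rightarrow> ('p \<times> 'e \<Rightarrow> real) \<Rightarrow> bool" where
  "strongly_psh_off_zero E h \<longleftrightarrow>
     (\<forall>(U, x, \<tau>)\<in>trivs E. \<forall>v. coords1 v \<in> U \<and> coords2 v \<noteq> 0 \<longrightarrow>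
        strongly_psh_at (\<lambda>u. h (total_param x \<tau> u)) v)"

definition negatively_curved ::
    "('p, 'e, 'd::finite, 'k::finite) hol_bundle \<Rightarrow> ('p \<times> 'e \<Rightarrow> real) \<Rightarrow> bool" where
  "negatively_curved E h \<longleftrightarrow> is_metric E h \<and> smooth_on_total E h \<and> strongly_psh_off_zero E h"

text \<open>Linear functionals on a fibre are made \<open>extensional\<close> (\<open>undefined\<close> off the fibre), so that each
  is represented by a unique HOL function.\<close>

definition fibre_dual :: "('p, 'e, 'd::finite, 'k::finite) hol_bundle \<Rightarrow> 'p \<Rightarrow> ('e \<Rightarrow> complex) set" where
  "fibre_dual E p =
     {\<phi> \<in> extensional (fibre E p).
        (\<forall>x\<in>fibre E p. \<forall>y\<in>fibre E p. \<phi> (fadd E p x y) = \<phi> x + \<phi> y) \<and>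
        (\<forall>c. \<forall>x\<in>fibre E p. \<phi> (fscale E p c x) = c * \<phi> x)}"

text \<open>The trivialization of the dual bundle dual to \<open>(U, x, \<tau>)\<close> sends \<open>t\<close> to the functional
  \<open>\<tau> z u \<mapsto> \<Sum>\<^sub>i t\<^sub>i u\<^sub>i\<close>.\<close>

definition dual_triv ::
    "('p, 'e, 'd::finite, 'k::finite) hol_bundle \<Rightarrow> (complex^'d \<Rightarrow> 'p) \<Rightarrow>
     (complex^'d \<Rightarrow> complex^'k \<Rightarrow> 'e) \<Rightarrow> complex^'d \<Rightarrow> complex^'k \<Rightarrow> ('e \<Rightarrow> complex)" where
  "dual_triv E x \<tau> z t =
     restrict (\<lambda>e. \<Sum>i\<in>UNIV. t $ i * inv_into UNIV (\<tau> z) e $ i) (fibre E (x z))"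

definition dual_bundle ::
    "('p, 'e, 'd::finite, 'k::finite) hol_bundle \<Rightarrow> ('p, 'e \<Rightarrow> complex, 'd, 'k) hol_bundle" where
  "dual_bundle E =
     \<lparr> base = base E,
       fibre = fibre_dual E,
       fzero = (\<lambda>p. restrict (\<lambda>x. 0) (fibre E p)),
       fadd = (\<lambda>p \<phi> \<psi>. restrict (\<lambda>x. \<phi> x + \<psi> x) (fibre E p)),
       fscale = (\<lambda>p c \<phi>. restrict (\<lambda>x. c * \<phi> x) (fibre E p)),
       trivs = (\<lambda>(U, x, \<tau>). (U, x, dual_triv E x \<tau>)) ` trivs E \<rparr>"

text \<open>Metrics are squares of norms, so the dual metric is the square of the dual norm.\<close>

definition dual_metric ::
    "('p, 'e, 'd::finite, 'k::finite) hol_bundle \<Rightarrow> ('p \<times> 'e \<Rightarrow> real) \<Rightarrow> 'p \<times> ('e \<Rightarrow> complex) \<Rightarrow> real" where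
  "dual_metric E h = (\<lambda>(p, \<phi>). SUP x\<in>fibre E p - {fzero E p}. (cmod (\<phi> x))\<^sup>2 / h (p, x))"

definition positively_curved ::
    "('p, 'e, 'd::finite, 'k::finite) hol_bundle \<Rightarrow> ('p \<times> 'e \<Rightarrow> real) \<Rightarrow> bool" where
  "positively_curved E h \<longleftrightarrow> is_metric E h \<and> negatively_curved (dual_bundle E) (dual_metric E h)"


section \<open>Spaces of hyperplanes and the bundles \<open>O(1)\<close>\<close>

text \<open>Throughout, a complex vector space \<open>V\<close> is the type \<open>'v\<close> with scalar multiplication \<open>sc\<close>.\<close>

definition hyperplanes :: "(complex \<Rightarrow> 'v::ab_group_add \<Rightarrow> 'v) \<Rightarrow> 'v set set" where
  "hyperplanes sc =
     {P. module.subspace sc P \<and> vector_space.dim sc P + 1 = vector_space.dim sc (UNIV :: 'v set)}"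

text \<open>The quotient vector space \<open>V/P\<close>; its elements are the cosets of \<open>P\<close>, its zero is \<open>P\<close>.\<close>

definition quot :: "'v::ab_group_add set \<Rightarrow> 'v set set" where
  "quot P = range (\<lambda>v. (+) v ` P)"

definition quot_add :: "'v::ab_group_add set \<Rightarrow> 'v set \<Rightarrow> 'v set \<Rightarrow> 'v set" where
  "quot_add P A B = {a + b | a b. a \<in> A \<and> b \<in> B}"

definition quot_scale ::
    "(complex \<Rightarrow> 'v::ab_group_add \<Rightarrow> 'v) \<Rightarrow> 'v set \<Rightarrow> complex \<Rightarrow> 'v set \<Rightarrow> 'v set" where
  "quot_scale sc P c A = {sc c a + p | a p. a \<in> A \<and> p \<in> P}"

text \<open>Bases of a vector space of dimension \<open>CARD('d) + 1\<close>, indexed by \<open>'d option\<close>.\<close>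

definition is_basis ::
    "(complex \<Rightarrow> 'v::ab_group_add \<Rightarrow> 'v) \<Rightarrow> ('d::finite option \<Rightarrow> 'v) \<Rightarrow> bool" where
  "is_basis sc b \<longleftrightarrow>
     inj b \<and> \<not> module.dependent sc (range b) \<and> module.span sc (range b) = UNIV"

text \<open>
  A basis \<open>b\<close> gives homogeneous coordinates on the space of hyperplanes: those of \<open>ker \<xi>\<close> are the
  coefficients of \<open>\<xi> \<in> V\<^sup>*\<close> in the dual basis. In the affine chart where the coefficient with index
  \<open>None\<close> does not vanish, \<open>w \<in> \<complex>\<^sup>d\<close> represents the kernel of the functional \<open>chart_functional sc b w\<close>.
  This functional induces an isomorphism \<open>V/P \<rightarrow> \<complex>\<close>, \<open>P\<close> being its kernel, and so trivializes \<open>O(1)\<close>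
  over the chart; the element of \<open>V/P\<close> sent to \<open>t\<close> is the coset on which the functional is \<open>t\<close>.
\<close>

definition chart_functional ::
    "(complex \<Rightarrow> 'v::ab_group_add \<Rightarrow> 'v) \<Rightarrow> ('d::finite option \<Rightarrow> 'v) \<Rightarrow> complex^'d \<Rightarrow> 'v \<Rightarrow> complex" where
  "chart_functional sc b w v =
     module.representation sc (range b) v (b None) +
     (\<Sum>i\<in>UNIV. w $ i * module.representation sc (range b) v (b (Some i)))"

definition chart_hyperplane ::
    "(complex \<Rightarrow> 'v::ab_group_add \<Rightarrow> 'v) \<Rightarrow> ('d::finite option \<Rightarrow> 'v) \<Rightarrow> complex^'d \<Rightarrow> 'v set" where
  "chart_hyperplane sc b w = {v. chart_functional sc b w v = 0}"

definition chart_coset ::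
    "(complex \<Rightarrow> 'v::ab_group_add \<Rightarrow> 'v) \<Rightarrow> ('d::finite option \<Rightarrow> 'v) \<Rightarrow> complex^'d \<Rightarrow> complex^unit \<Rightarrow> 'v set" where
  "chart_coset sc b w t = {v. chart_functional sc b w v = t $ ()}"

text \<open>The line bundle \<open>O(1)\<close> over the space of hyperplanes of \<open>V\<close>, where \<open>dim V = CARD('d) + 1\<close>.\<close>

definition O1_PV ::
    "(complex \<Rightarrow> 'v::ab_group_add \<Rightarrow> 'v) \<Rightarrow> ('v set, 'v set, 'd::finite, unit) hol_bundle" where
  "O1_PV sc =
     \<lparr> base = hyperplanes sc,
       fibre = quot,
       fzero = (\<lambda>P. P),
       fadd = quot_add,
       fscale = quot_scale sc,
       trivs = {(UNIV, chart_hyperplane sc b, chart_coset sc b) | b. is_basis sc b} \<rparr>"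

text \<open>
  The line bundle \<open>O(1)\<close> over the space \<open>B \<times> PV\<close> of hyperplanes in the fibres of the trivial bundle
  \<open>B \<times> V \<rightarrow> B\<close>, for an open set \<open>B \<subseteq> \<complex>\<^sup>m\<close>, \<open>m = CARD('m)\<close>. The fibre \<open>{s} \<times> V\<close> is identified with \<open>V\<close>, so
  that a hyperplane in it is a pair \<open>(s, P)\<close> with \<open>P\<close> a hyperplane of \<open>V\<close>, and the fibre of \<open>O(1)\<close> over
  \<open>(s, P)\<close> is \<open>V/P\<close>.
\<close>

definition O1_PF ::
    "(complex^'m::finite) set \<Rightarrow> (complex \<Rightarrow> 'v::ab_group_add \<Rightarrow> 'v) \<Rightarrow>
     ((complex^'m) \<times> 'v set, 'v set, 'm + 'd::finite, unit) hol_bundle" where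
  "O1_PF B sc =
     \<lparr> base = B \<times> hyperplanes sc,
       fibre = (\<lambda>(s, P). quot P),
       fzero = (\<lambda>(s, P). P),
       fadd = (\<lambda>(s, P). quot_add P),
       fscale = (\<lambda>(s, P). quot_scale sc P),
       trivs = {({z. coords1 z \<in> B},
                 \<lambda>z. (coords1 z, chart_hyperplane sc b (coords2 z)),
                 \<lambda>z. chart_coset sc b (coords2 z)) | b. is_basis sc b} \<rparr>"

end

theory Submission
  imports Defs "HOL-Computational_Algebra.Polynomial"
begin

text \<open>
  In a trivialization write \<open>\<kappa>\<^sub>j = |t|\<^sup>2 exp (- \<phi>\<^sub>j)\<close>; positive curvature means that \<open>\<phi>\<^sub>j\<close> is strongly
  plurisubharmonic, and \<open>\<phi>\<^sub>1 < \<phi>\<^sub>2 < \<phi>\<^sub>3\<close>. By compactness of \<open>PV\<close> the differences lie between two positive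
  constants. So there are slopes \<open>A\<^sub>j > 0\<close> and \<open>0 < \<sigma>\<^sub>1 < \<sigma>\<^sub>2 < \<sigma>\<^sub>3 < 1\<close> such that, when \<open>|s|\<^sup>2\<close> is close to
  \<open>\<sigma>\<^sub>j\<close>, the weight \<open>\<phi>\<^sub>j + A\<^sub>j (|s|\<^sup>2 - \<sigma>\<^sub>j)\<close> exceeds the other two by a fixed margin. The weight of \<open>k\<close>
  is a regularized maximum of the three. Since a regularized maximum commutes with adding a constant to
  all arguments, \<open>k\<close> does not depend on the trivialization and is quadratic on the fibres.
\<close>

section \<open>Smooth functions\<close>

lemma higher_differentiable_on_cong:
  assumes "open U" "\<And>x. x \<in> U \<Longrightarrow> f x = g x" "higher_differentiable_on U f n"
  shows "higher_differentiable_on U g n"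
  using assms(2,3)
proof (induction n arbitrary: f g)
  case 0
  then show ?case by (simp cong: continuous_on_cong)
next
  case (Suc n)
  have g: "(g has_derivative frechet_derivative f (at x)) (at x)" if "x \<in> U" for x
    using has_derivative_transform_within_open[OF _ assms(1) that Suc.prems(1)] Suc.prems(2) that
    by (auto simp: frechet_derivative_works)
  then have "frechet_derivative f (at x) = frechet_derivative g (at x)" if "x \<in> U" for x
    using frechet_derivative_at that by blast
  then have "higher_differentiable_on U (\<lambda>x. frechet_derivative g (at x) v) n" for v
    using Suc.IH[of "\<lambda>x. frechet_derivative f (at x) v"] Suc.prems(2) by auto
  with g show ?case by (auto simp: differentiable_def)
qed

lemma higher_differentiable_on_SucI:
  assumes "open U" "\<And>x. x \<in> U \<Longrightarrow> (f has_derivative f' x) (at x)"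
    "\<And>v. higher_differentiable_on U (\<lambda>x. f' x v) n"
  shows "higher_differentiable_on U f (Suc n)"
proof -
  have "f' x = frechet_derivative f (at x)" if "x \<in> U" for x
    using frechet_derivative_at assms(2) that by blast
  then have "higher_differentiable_on U (\<lambda>x. frechet_derivative f (at x) v) n" for v
    by (intro higher_differentiable_on_cong[OF assms(1) _ assms(3)[of v]]) auto
  with assms(2) show ?thesis by (auto simp: differentiable_def)
qed

lemma higher_differentiable_on_SucD:
  assumes "higher_differentiable_on U f (Suc n)"
  shows "x \<in> U \<Longrightarrow> (f has_derivative frechet_derivative f (at x)) (at x)"
    and "higher_differentiable_on U (\<lambda>x. frechet_derivative f (at x) v) n"
  using assms by (auto simp: frechet_derivative_works)

lemma higher_differentiable_on_Suc_lower:
  "higher_differentiable_on U f (Suc n) \<Longrightarrow> higher_differentiable_on U f n"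
proof (induction n arbitrary: f)
  case 0
  then show ?case
    by (auto intro!: continuous_at_imp_continuous_on differentiable_imp_continuous_within)
next
  case (Suc n)
  then show ?case by (metis higher_differentiable_on.simps(2))
qed

lemma higher_differentiable_on_const: "open U \<Longrightarrow> higher_differentiable_on U (\<lambda>x. c) n"
proof (induction n arbitrary: c)
  case (Suc n)
  then show ?case
    by (intro higher_differentiable_on_SucI[where f' = "\<lambda>_ _. 0"]) (auto intro: has_derivative_const)
qed auto

lemma higher_differentiable_on_linear:
  assumes "open U" "bounded_linear f"
  shows "higher_differentiable_on U f n"
proof (cases n)
  case 0
  then show ?thesis using assms by (simp add: linear_continuous_on)
next
  case (Suc m)
  show ?thesis unfolding Suc
    using assms by (intro higher_differentiable_on_SucI[where f' = "\<lambda>_. f"])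
      (auto intro: bounded_linear_imp_has_derivative higher_differentiable_on_const)
qed

lemma higher_differentiable_on_add:
  assumes "open U"
  shows "higher_differentiable_on U f n \<Longrightarrow> higher_differentiable_on U g n \<Longrightarrow>
    higher_differentiable_on U (\<lambda>x. f x + g x) n"
proof (induction n arbitrary: f g)
  case 0
  then show ?case by (simp add: continuous_on_add)
next
  case (Suc n)
  show ?case
    by (rule higher_differentiable_on_SucI[OF assms
          has_derivative_add[OF higher_differentiable_on_SucD(1)[OF Suc.prems(1)]
            higher_differentiable_on_SucD(1)[OF Suc.prems(2)]]
          Suc.IH[OF higher_differentiable_on_SucD(2)[OF Suc.prems(1)]
            higher_differentiable_on_SucD(2)[OF Suc.prems(2)]]])
qed

lemma higher_differentiable_on_mult:
  fixes f g :: "'a::real_normed_vector \<Rightarrow> 'b::real_normed_algebra"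
  assumes "open U"
  shows "higher_differentiable_on U f n \<Longrightarrow> higher_differentiable_on U g n \<Longrightarrow>
    higher_differentiable_on U (\<lambda>x. f x * g x) n"
proof (induction n arbitrary: f g)
  case 0
  then show ?case by (simp add: continuous_on_mult)
next
  case (Suc n)
  note f = Suc.prems(1) and g = Suc.prems(2)
  show ?case
    by (rule higher_differentiable_on_SucI[OF assms
          has_derivative_mult[OF higher_differentiable_on_SucD(1)[OF f]
            higher_differentiable_on_SucD(1)[OF g]]])
      (auto intro!: higher_differentiable_on_add assms Suc.IH higher_differentiable_on_SucD(2) f g
        higher_differentiable_on_Suc_lower[of U f] higher_differentiable_on_Suc_lower[of U g]
        simp del: higher_differentiable_on.simps)
qed

lemma higher_differentiable_on_affine:
  assumes "open U" "open W" "bounded_linear L" "\<And>x. x \<in> W \<Longrightarrow> c + L x \<in> U"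
  shows "higher_differentiable_on U f n \<Longrightarrow> higher_differentiable_on W (\<lambda>x. f (c + L x)) n"
proof (induction n arbitrary: f)
  case 0
  have "continuous_on W (\<lambda>x. c + L x)"
    using assms(3) by (intro continuous_intros linear_continuous_on)
  then have "continuous_on W (f \<circ> (\<lambda>x. c + L x))"
    using 0 assms(4) by (intro continuous_on_compose) (auto intro: continuous_on_subset)
  then show ?case by (simp add: o_def)
next
  case (Suc n)
  have "((\<lambda>x. f (c + L x)) has_derivative (\<lambda>v. frechet_derivative f (at (c + L x)) (L v))) (at x)"
    if "x \<in> W" for x
  proof -
    have "((\<lambda>x. c + L x) has_derivative L) (at x)"
      using has_derivative_add[OF has_derivative_const bounded_linear_imp_has_derivative[OF assms(3)]]
      by simp
    from diff_chain_at[OF this higher_differentiable_on_SucD(1)[OF Suc.prems]] assms(4) that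
    show ?thesis by (simp add: o_def)
  qed
  then show ?case
    by (rule higher_differentiable_on_SucI[OF assms(2)])
      (assumption, rule Suc.IH[OF higher_differentiable_on_SucD(2)[OF Suc.prems]])
qed

lemma frechet_derivative_real:
  fixes g :: "real \<Rightarrow> 'b::real_normed_vector"
  assumes "g differentiable (at y)"
  shows "frechet_derivative g (at y) h = h *\<^sub>R frechet_derivative g (at y) 1"
  using linear_cmul[OF linear_frechet_derivative[OF assms], of h 1] by simp

lemma higher_differentiable_on_compose:
  fixes f :: "'a::real_normed_vector \<Rightarrow> real" and g :: "real \<Rightarrow> real"
  assumes "open U" "\<And>x. x \<in> U \<Longrightarrow> f x \<in> S"
  shows "higher_differentiable_on S g n \<Longrightarrow> higher_differentiable_on U f n \<Longrightarrow>
    higher_differentiable_on U (\<lambda>x. g (f x)) n"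
proof (induction n arbitrary: g)
  case 0
  then have "continuous_on U (g \<circ> f)"
    using assms(2) by (intro continuous_on_compose) (auto intro: continuous_on_subset)
  then show ?case by (simp add: o_def)
next
  case (Suc n)
  note g = Suc.prems(1) and f = Suc.prems(2)
  have "((\<lambda>x. g (f x)) has_derivative
      (\<lambda>v. frechet_derivative f (at x) v * frechet_derivative g (at (f x)) 1)) (at x)" if "x \<in> U" for x
  proof -
    have "((\<lambda>x. g (f x)) has_derivative
        (\<lambda>v. frechet_derivative g (at (f x)) (frechet_derivative f (at x) v))) (at x)"
      using diff_chain_at[OF higher_differentiable_on_SucD(1)[OF f that]
          higher_differentiable_on_SucD(1)[OF g assms(2)[OF that]]] by (simp add: o_def)
    moreover have "g differentiable (at (f x))" using g assms(2)[OF that] by simp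
    ultimately show ?thesis by (subst (asm) frechet_derivative_real) auto
  qed
  then show ?case
    by (rule higher_differentiable_on_SucI[OF assms(1)])
      (auto intro!: higher_differentiable_on_mult assms(1) Suc.IH higher_differentiable_on_SucD(2) f g
        higher_differentiable_on_Suc_lower[OF f] simp del: higher_differentiable_on.simps)
qed

named_theorems smooth_intros

lemma smooth_on_subset:
  assumes "smooth_on U f" "V \<subseteq> U"
  shows "smooth_on V f"
proof -
  have "higher_differentiable_on U f n \<Longrightarrow> higher_differentiable_on V f n" for n
    using assms(2) by (induction n arbitrary: f) (auto intro: continuous_on_subset)
  then show ?thesis using assms(1) by (simp add: smooth_on_def)
qed

lemma smooth_on_const [smooth_intros]: "open U \<Longrightarrow> smooth_on U (\<lambda>x. c)"
  by (simp add: smooth_on_def higher_differentiable_on_const)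

lemma smooth_on_linear: "open U \<Longrightarrow> bounded_linear f \<Longrightarrow> smooth_on U f"
  by (simp add: smooth_on_def higher_differentiable_on_linear)

lemma smooth_on_id [smooth_intros]: "open U \<Longrightarrow> smooth_on U (\<lambda>x. x)"
  by (intro smooth_on_linear bounded_linear_ident)

lemma smooth_on_add [smooth_intros]:
  "open U \<Longrightarrow> smooth_on U f \<Longrightarrow> smooth_on U g \<Longrightarrow> smooth_on U (\<lambda>x. f x + g x)"
  by (simp add: smooth_on_def higher_differentiable_on_add)

lemma smooth_on_mult [smooth_intros]:
  fixes f g :: "'a::real_normed_vector \<Rightarrow> 'b::real_normed_algebra"
  shows "open U \<Longrightarrow> smooth_on U f \<Longrightarrow> smooth_on U g \<Longrightarrow> smooth_on U (\<lambda>x. f x * g x)"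
  by (simp add: smooth_on_def higher_differentiable_on_mult)

lemma smooth_on_diff [smooth_intros]:
  fixes f g :: "'a::real_normed_vector \<Rightarrow> 'b::real_normed_algebra_1"
  assumes "open U" "smooth_on U f" "smooth_on U g"
  shows "smooth_on U (\<lambda>x. f x - g x)"
  using smooth_on_add[OF assms(1,2) smooth_on_mult[OF assms(1) smooth_on_const[OF assms(1)] assms(3)],
    of "- 1"] by simp

lemma smooth_on_affine:
  assumes "open U" "open W" "bounded_linear L" "\<And>x. x \<in> W \<Longrightarrow> c + L x \<in> U" "smooth_on U f"
  shows "smooth_on W (\<lambda>x. f (c + L x))"
  using assms unfolding smooth_on_def by (intro allI higher_differentiable_on_affine[of U W L c f]) auto

lemma smooth_on_compose:
  fixes f :: "'a::real_normed_vector \<Rightarrow> real" and g :: "real \<Rightarrow> real"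
  assumes "open U" "smooth_on S g" "smooth_on U f" "\<And>x. x \<in> U \<Longrightarrow> f x \<in> S"
  shows "smooth_on U (\<lambda>x. g (f x))"
  using assms unfolding smooth_on_def by (intro allI higher_differentiable_on_compose[of U f S g]) auto

lemma smooth_on_DERIV:
  fixes f f' :: "real \<Rightarrow> real"
  assumes "open U" "\<And>x. x \<in> U \<Longrightarrow> (f has_real_derivative f' x) (at x)" "smooth_on U f'"
  shows "smooth_on U f"
  unfolding smooth_on_def
proof
  fix n
  show "higher_differentiable_on U f n"
  proof (rule higher_differentiable_on_Suc_lower, rule higher_differentiable_on_SucI[OF assms(1)])
    show "(f has_derivative (*) (f' x)) (at x)" if "x \<in> U" for x
      using assms(2)[OF that] by (simp add: has_field_derivative_def)
    show "higher_differentiable_on U (\<lambda>x. f' x * v) n" for v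
      using assms(3) by (auto simp: smooth_on_def intro!: higher_differentiable_on_mult
          higher_differentiable_on_const assms(1))
  qed
qed

lemma smooth_on_deriv_family:
  fixes f :: "'i \<Rightarrow> real \<Rightarrow> real"
  assumes "open U" "\<And>i x. x \<in> U \<Longrightarrow> (f i has_real_derivative f (s i) x) (at x)"
  shows "smooth_on U (f i)"
proof -
  have "higher_differentiable_on U (f i) n" for n i
  proof (induction n arbitrary: i)
    case 0
    show ?case
      using assms(2) by (auto intro!: continuous_at_imp_continuous_on DERIV_isCont)
  next
    case (Suc n)
    show ?case
    proof (rule higher_differentiable_on_SucI[OF assms(1)])
      show "(f i has_derivative (*) (f (s i) x)) (at x)" if "x \<in> U" for x
        using assms(2)[OF that] by (simp add: has_field_derivative_def)
      show "higher_differentiable_on U (\<lambda>x. f (s i) x * v) n" for v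
        by (intro higher_differentiable_on_mult higher_differentiable_on_const assms(1) Suc)
    qed
  qed
  then show ?thesis by (simp add: smooth_on_def)
qed

lemma smooth_on_exp: "smooth_on UNIV (exp :: real \<Rightarrow> real)"
  by (rule smooth_on_deriv_family[where f = "\<lambda>_::unit. exp" and s = id])
    (auto intro!: derivative_eq_intros)

lemma smooth_on_inverse: "smooth_on {0<..} (inverse :: real \<Rightarrow> real)"
proof -
  have "smooth_on {0<..} ((\<lambda>(c, n) x. c * inverse x ^ Suc n) (1::real, 0::nat))"
  proof (rule smooth_on_deriv_family[where s = "\<lambda>(c, n). (- c * (real n + 1), Suc n)"])
    fix i :: "real \<times> nat" and x :: real assume x: "x \<in> {0<..}"
    obtain c n where i: "i = (c, n)" by fastforce
    have "((\<lambda>x. inverse x ^ Suc n) has_real_derivative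
        real (Suc n) * (- (inverse x ^ Suc (Suc 0)) * inverse x ^ (Suc n - Suc 0))) (at x)"
      by (intro DERIV_power DERIV_inverse) (use x in simp)
    from DERIV_cmult[OF this, of c]
    have "((\<lambda>x. c * inverse x ^ Suc n) has_real_derivative
        c * (real (Suc n) * (- (inverse x ^ Suc (Suc 0)) * inverse x ^ n))) (at x)"
      by simp
    then show "((case i of (c, n) \<Rightarrow> \<lambda>x. c * inverse x ^ Suc n) has_real_derivative
        (case case i of (c, n) \<Rightarrow> (- c * (real n + 1), Suc n) of
          (c, n) \<Rightarrow> \<lambda>x. c * inverse x ^ Suc n) x) (at x)"
      by (simp add: i algebra_simps)
  qed simp
  then show ?thesis by simp
qed

lemma smooth_on_ln: "smooth_on {0<..} (ln :: real \<Rightarrow> real)"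
  by (rule smooth_on_DERIV[OF _ _ smooth_on_inverse])
    (auto intro!: derivative_eq_intros simp: field_simps)

section \<open>A smooth regularization of the positive part\<close>

definition flat_exp :: "real poly \<Rightarrow> real \<Rightarrow> real" where
  "flat_exp p x = (if x > 0 then poly p (1 / x) * exp (- (1 / x)) else 0)"

lemma poly_times_exp_tendsto_0:
  "((\<lambda>x. poly p x * exp (- x)) \<longlongrightarrow> (0::real)) at_top"
proof -
  have "((\<lambda>x. \<Sum>i\<le>degree p. coeff p i * (x ^ i / exp x)) \<longlongrightarrow> (\<Sum>i\<le>degree p. coeff p i * 0)) at_top"
    by (intro tendsto_intros tendsto_power_div_exp_0)
  then show ?thesis
    by (simp add: poly_altdef sum_distrib_right exp_minus divide_inverse mult.assoc)
qed

lemma flat_exp_DERIV: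
  "(flat_exp p has_real_derivative flat_exp ([:0, 0, 1:] * (p - pderiv p)) x) (at x)"
proof -
  consider "x > 0" | "x < 0" | "x = 0" by linarith
  then show ?thesis
  proof cases
    case 1
    have "((\<lambda>x. poly p (1 / x) * exp (- (1 / x))) has_real_derivative
        flat_exp ([:0, 0, 1:] * (p - pderiv p)) x) (at x)"
      using 1 by (auto intro!: derivative_eq_intros DERIV_chain2[OF poly_DERIV]
          simp: flat_exp_def field_simps power2_eq_square)
    then show ?thesis
      by (rule has_field_derivative_transform_within_open[of _ _ _ "{0<..}"])
        (use 1 in \<open>auto simp: flat_exp_def\<close>)
  next
    case 2
    then have *: "flat_exp ([:0, 0, 1:] * (p - pderiv p)) x = 0" by (simp add: flat_exp_def)
    have "((\<lambda>x. 0) has_real_derivative 0) (at x)" by simp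
    then show ?thesis unfolding *
      by (rule has_field_derivative_transform_within_open[of _ _ _ "{..<0}"])
        (use 2 in \<open>auto simp: flat_exp_def\<close>)
  next
    case 3
    have "((\<lambda>h. flat_exp p h / h) \<longlongrightarrow> 0) (at_left 0)"
      by (rule tendsto_eventually) (auto simp: eventually_at_filter flat_exp_def)
    moreover have "((\<lambda>h. flat_exp p h / h) \<longlongrightarrow> 0) (at_right 0)"
    proof (rule Lim_transform_eventually)
      show "((\<lambda>h. poly (pCons 0 p) (inverse h) * exp (- inverse h)) \<longlongrightarrow> 0) (at_right 0)"
        by (rule filterlim_compose[OF poly_times_exp_tendsto_0 filterlim_inverse_at_top_right])
      show "\<forall>\<^sub>F h in at_right 0. poly (pCons 0 p) (inverse h) * exp (- inverse h) = flat_exp p h / h"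
        by (auto simp: eventually_at_filter flat_exp_def field_simps)
    qed
    ultimately have "((\<lambda>h. flat_exp p h / h) \<longlongrightarrow> 0) (at 0)"
      by (simp add: filterlim_split_at)
    then show ?thesis
      by (simp add: 3 DERIV_def flat_exp_def)
  qed
qed

lemma smooth_flat_exp: "smooth_on UNIV (flat_exp p)"
  by (rule smooth_on_deriv_family[where f = flat_exp and s = "\<lambda>p. [:0, 0, 1:] * (p - pderiv p)"])
    (rule open_UNIV, rule flat_exp_DERIV)

lemma exists_smooth_bump:
  "\<exists>\<psi> :: real \<Rightarrow> real. smooth_on UNIV \<psi> \<and> (\<forall>x. \<psi> (- x) = \<psi> x) \<and> (\<forall>x. \<psi> x \<ge> 0) \<and>
     (\<forall>x. \<bar>x\<bar> < 1 \<longrightarrow> \<psi> x > 0) \<and> (\<forall>x. \<bar>x\<bar> \<ge> 1 \<longrightarrow> \<psi> x = 0)"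
proof (intro exI conjI allI impI)
  let ?\<psi> = "\<lambda>x. flat_exp 1 (1 + x) * flat_exp 1 (1 - x)"
  have "smooth_on UNIV (\<lambda>x. flat_exp 1 (1 + x))" "smooth_on UNIV (\<lambda>x. flat_exp 1 (1 - x))"
    by (rule smooth_on_compose[OF _ smooth_flat_exp]; force intro!: smooth_intros)+
  then show "smooth_on UNIV ?\<psi>" by (intro smooth_intros) auto
  show "?\<psi> (- x) = ?\<psi> x" for x by simp
  show "?\<psi> x \<ge> 0" for x by (simp add: flat_exp_def)
  show "?\<psi> x > 0" if "\<bar>x\<bar> < 1" for x using that by (auto simp: flat_exp_def)
  show "?\<psi> x = 0" if "\<bar>x\<bar> \<ge> 1" for x using that by (auto simp: flat_exp_def)
qed

lemma smooth_on_imp_isCont: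
  assumes "smooth_on UNIV f"
  shows "isCont f x"
  using assms by (metis smooth_on_def higher_differentiable_on.simps(1) continuous_on_eq_continuous_at
      open_UNIV UNIV_I)

lemma exists_antiderivative:
  fixes f :: "real \<Rightarrow> real"
  assumes "\<And>x. isCont f x"
  shows "\<exists>F. \<forall>x. (F has_real_derivative f x) (at x)"
  using einterval_antiderivative[of "-\<infinity>" "\<infinity>" f] assms
  by (auto simp: has_real_derivative_iff_has_vector_derivative)

lemma DERIV_zero_eq_on:
  fixes F f :: "real \<Rightarrow> real"
  assumes "\<And>x. (F has_real_derivative f x) (at x)" "\<And>x. a \<le> x \<Longrightarrow> x \<le> b \<Longrightarrow> f x = 0" "a \<le> b"
  shows "F a = F b"
proof (cases "a < b")
  case True
  obtain z where "a < z" "z < b" "F b - F a = (b - a) * f z"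
    using MVT2[OF True, of F f] assms(1) by blast
  then show ?thesis using assms(2)[of z] by simp
qed (use assms(3) in auto)

text \<open>The antiderivative of the normalized bump is a smooth step; that of the step is the regularized
  positive part. Evenness of the bump fixes the integration constant for large arguments.\<close>

lemma exists_regularized_pos_part_unit:
  "\<exists>\<theta> \<theta>1 \<theta>2 :: real \<Rightarrow> real. smooth_on UNIV \<theta> \<and>
     (\<forall>x. (\<theta> has_real_derivative \<theta>1 x) (at x)) \<and> (\<forall>x. (\<theta>1 has_real_derivative \<theta>2 x) (at x)) \<and>
     (\<forall>x. 0 \<le> \<theta>1 x \<and> \<theta>1 x \<le> 1 \<and> 0 \<le> \<theta>2 x) \<and>
     (\<forall>x\<le>-1. \<theta> x = 0) \<and> (\<forall>x\<ge>1. \<theta> x = x)"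
proof -
  obtain \<psi> :: "real \<Rightarrow> real" where smooth: "smooth_on UNIV \<psi>" and even: "\<And>x. \<psi> (- x) = \<psi> x"
    and nn: "\<And>x. \<psi> x \<ge> 0" and pos: "\<And>x. \<bar>x\<bar> < 1 \<Longrightarrow> \<psi> x > 0" and zero: "\<And>x. \<bar>x\<bar> \<ge> 1 \<Longrightarrow> \<psi> x = 0"
    using exists_smooth_bump by blast
  obtain F where F: "\<And>x. (F has_real_derivative \<psi> x) (at x)"
    using exists_antiderivative smooth_on_imp_isCont[OF smooth] by blast
  have mono: "F x \<le> F y" if "x \<le> y" for x y
    using DERIV_nonneg_imp_nondecreasing[OF that] F nn by blast
  obtain z where "-1 < z" "z < 1" "F 1 - F (-1) = (1 - (-1)) * \<psi> z"
    using MVT2[of "-1" 1 F \<psi>] F by auto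
  then have c: "F 1 - F (-1) > 0" using pos[of z] by (simp add: abs_if)
  define c where "c = F 1 - F (-1)"
  define \<theta>1 where "\<theta>1 x = (F x - F (-1)) / c" for x
  define \<theta>2 where "\<theta>2 x = \<psi> x / c" for x
  have c0: "c > 0" using c by (simp add: c_def)
  have low: "F x = F (-1)" if "x \<le> -1" for x
    using DERIV_zero_eq_on[OF F, of x "-1"] zero that by auto
  have high: "F x = F 1" if "x \<ge> 1" for x
    using DERIV_zero_eq_on[OF F, of 1 x] zero that by auto
  have d1: "(\<theta>1 has_real_derivative \<theta>2 x) (at x)" for x
    unfolding \<theta>1_def \<theta>2_def using c0 by (auto intro!: derivative_eq_intros F)
  have "smooth_on UNIV (\<lambda>x. \<psi> x * (1 / c))" by (intro smooth_intros smooth) auto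
  then have s1: "smooth_on UNIV \<theta>1"
    using smooth_on_DERIV[of UNIV \<theta>1 \<theta>2] d1 by (simp add: \<theta>2_def[abs_def])
  obtain G where G: "\<And>x. (G has_real_derivative \<theta>1 x) (at x)"
    using exists_antiderivative smooth_on_imp_isCont[OF s1] by blast
  define \<theta> where "\<theta> x = G x - G (-1)" for x
  have d0: "(\<theta> has_real_derivative \<theta>1 x) (at x)" for x
    unfolding \<theta>_def by (auto intro!: derivative_eq_intros G)
  have s0: "smooth_on UNIV \<theta>"
    by (rule smooth_on_DERIV[OF _ d0 s1]) auto
  have \<theta>1_low: "\<theta>1 x = 0" if "x \<le> -1" for x using low[OF that] by (simp add: \<theta>1_def)
  have \<theta>1_bounds: "0 \<le> \<theta>1 x \<and> \<theta>1 x \<le> 1" for x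
  proof -
    have "F (-1) \<le> F x" using mono[of "-1" x] low[of x] by (metis linear order_refl)
    moreover have "F x \<le> F 1" using mono[of x 1] high[of x] by (metis linear order_refl)
    ultimately show ?thesis using c0 by (auto simp: \<theta>1_def c_def field_simps)
  qed
  have mirror: "((\<lambda>x. h (- x)) has_real_derivative - h' (- x)) (at x)"
    if "\<And>x. (h has_real_derivative h' x) (at x)" for h h' :: "real \<Rightarrow> real" and x
    using DERIV_chain2[OF that DERIV_minus[OF DERIV_ident]] by simp
  have "((\<lambda>x. \<theta>1 x + \<theta>1 (- x)) has_real_derivative 0) (at x)" for x
    using DERIV_add[OF d1[of x] mirror[OF d1, of x]] by (simp add: \<theta>2_def even)
  then have const1: "\<theta>1 x + \<theta>1 (- x) = \<theta>1 1 + \<theta>1 (- 1)" for x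
    using DERIV_isconst_all[of "\<lambda>x. \<theta>1 x + \<theta>1 (- x)" x 1] by blast
  have "\<theta>1 1 + \<theta>1 (- 1) = 1" using c0 by (simp add: \<theta>1_def c_def)
  then have sym: "\<theta>1 x + \<theta>1 (- x) = 1" for x using const1[of x] by linarith
  have "((\<lambda>x. \<theta> x - \<theta> (- x) - x) has_real_derivative 0) (at x)" for x
    using DERIV_diff[OF DERIV_diff[OF d0[of x] mirror[OF d0, of x]] DERIV_ident] sym[of x] by simp
  then have const: "\<theta> x - \<theta> (- x) - x = \<theta> 0 - \<theta> (- 0) - 0" for x
    using DERIV_isconst_all[of "\<lambda>x. \<theta> x - \<theta> (- x) - x" x 0] by blast
  have odd: "\<theta> x = \<theta> (- x) + x" for x using const[of x] by simp
  have \<theta>_low: "\<theta> x = 0" if "x \<le> -1" for x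
    using DERIV_zero_eq_on[OF G, of x "-1"] \<theta>1_low that by (auto simp: \<theta>_def)
  have "\<theta> x = x" if "x \<ge> 1" for x using odd[of x] \<theta>_low[of "- x"] that by simp
  moreover have "0 \<le> \<theta>2 x" for x using nn[of x] c0 by (simp add: \<theta>2_def)
  ultimately show ?thesis using s0 d0 d1 \<theta>1_bounds \<theta>_low by blast
qed

lemma exists_regularized_pos_part:
  assumes "\<epsilon> > 0"
  shows "\<exists>\<theta> \<theta>1 \<theta>2 :: real \<Rightarrow> real. smooth_on UNIV \<theta> \<and>
     (\<forall>x. (\<theta> has_real_derivative \<theta>1 x) (at x)) \<and> (\<forall>x. (\<theta>1 has_real_derivative \<theta>2 x) (at x)) \<and>
     (\<forall>x. 0 \<le> \<theta>1 x \<and> \<theta>1 x \<le> 1 \<and> 0 \<le> \<theta>2 x) \<and>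
     (\<forall>x\<le>-\<epsilon>. \<theta> x = 0) \<and> (\<forall>x\<ge>\<epsilon>. \<theta> x = x)"
proof -
  obtain \<theta> \<theta>1 \<theta>2 :: "real \<Rightarrow> real" where s: "smooth_on UNIV \<theta>"
    and d0: "\<And>x. (\<theta> has_real_derivative \<theta>1 x) (at x)" and d1: "\<And>x. (\<theta>1 has_real_derivative \<theta>2 x) (at x)"
    and b: "\<And>x. 0 \<le> \<theta>1 x \<and> \<theta>1 x \<le> 1 \<and> 0 \<le> \<theta>2 x"
    and low: "\<And>x. x \<le> -1 \<Longrightarrow> \<theta> x = 0" and high: "\<And>x. x \<ge> 1 \<Longrightarrow> \<theta> x = x"
    using exists_regularized_pos_part_unit by blast
  show ?thesis
  proof (intro exI conjI allI impI)
    let ?\<theta> = "\<lambda>x. \<epsilon> * \<theta> (x * (1 / \<epsilon>))"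
    have "smooth_on UNIV (\<lambda>x. x * (1 / \<epsilon>))"
      by (intro smooth_intros open_UNIV)
    then have "smooth_on UNIV (\<lambda>x. \<theta> (x * (1 / \<epsilon>)))"
      by (rule smooth_on_compose[OF open_UNIV s]) simp
    then show "smooth_on UNIV ?\<theta>" by (intro smooth_intros) auto
    show "(?\<theta> has_real_derivative \<theta>1 (x * (1 / \<epsilon>))) (at x)" for x
      using assms by (auto intro!: derivative_eq_intros DERIV_chain2[OF d0])
    show "((\<lambda>x. \<theta>1 (x * (1 / \<epsilon>))) has_real_derivative \<theta>2 (x * (1 / \<epsilon>)) * (1 / \<epsilon>)) (at x)" for x
    proof -
      have "((\<lambda>x. x * (1 / \<epsilon>)) has_real_derivative 1 / \<epsilon>) (at x)"
        using assms by (auto intro!: derivative_eq_intros)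
      from DERIV_chain2[OF d1 this] show ?thesis .
    qed
    show "0 \<le> \<theta>1 (x * (1 / \<epsilon>))" "\<theta>1 (x * (1 / \<epsilon>)) \<le> 1" "0 \<le> \<theta>2 (x * (1 / \<epsilon>)) * (1 / \<epsilon>)" for x
      using b assms by auto
    show "?\<theta> x = 0" if "x \<le> -\<epsilon>" for x
      using low[of "x * (1 / \<epsilon>)"] that assms by (simp add: field_simps)
    show "?\<theta> x = x" if "x \<ge> \<epsilon>" for x
      using high[of "x * (1 / \<epsilon>)"] that assms by (simp add: field_simps)
  qed
qed

section \<open>Second derivatives along lines and the Levi form\<close>

definition jet2 :: "(real \<Rightarrow> real) \<Rightarrow> real \<Rightarrow> real \<Rightarrow> bool" where
  "jet2 g p q \<longleftrightarrow> (\<exists>g1. g1 0 = p \<and> (\<forall>\<^sub>F x in nhds 0. (g has_real_derivative g1 x) (at x)) \<and>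
     (g1 has_real_derivative q) (at 0))"

lemma jet2_DERIV: "jet2 g p q \<Longrightarrow> (g has_real_derivative p) (at 0)"
  unfolding jet2_def by (metis eventually_nhds_x_imp_x)

lemma jet2_unique:
  assumes "jet2 g p q" "jet2 g p' q'"
  shows "p = p'" "q = q'"
proof -
  show "p = p'" using assms[THEN jet2_DERIV] DERIV_unique by blast
  obtain g1 g2 where g1: "\<forall>\<^sub>F x in nhds 0. (g has_real_derivative g1 x) (at x)"
    "(g1 has_real_derivative q) (at 0)"
    and g2: "\<forall>\<^sub>F x in nhds 0. (g has_real_derivative g2 x) (at x)"
    "(g2 has_real_derivative q') (at 0)"
    using assms unfolding jet2_def by blast
  have "\<forall>\<^sub>F x in nhds 0. g1 x = g2 x"
    using g1(1) g2(1) by eventually_elim (rule DERIV_unique)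
  then have "(g1 has_real_derivative q') (at 0)"
    using g2(2) DERIV_cong_ev[OF refl _ refl] by blast
  with g1(2) show "q = q'" using DERIV_unique by blast
qed

lemma jet2_global:
  assumes "\<And>x. (g has_real_derivative g1 x) (at x)" "(g1 has_real_derivative q) (at 0)"
  shows "jet2 g (g1 0) q"
  unfolding jet2_def using assms by (intro exI[of _ g1]) auto

lemma jet2_quadratic: "jet2 (\<lambda>x. a + b * x + c * x\<^sup>2) b (2 * c)"
proof -
  have "jet2 (\<lambda>x. a + b * x + c * x\<^sup>2) (b + 2 * c * 0) (2 * c)"
    by (rule jet2_global[where ?g1.0 = "\<lambda>x. b + 2 * c * x"]) (auto intro!: derivative_eq_intros)
  then show ?thesis by simp
qed

lemma jet2_add:
  assumes "jet2 f p q" "jet2 g p' q'"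
  shows "jet2 (\<lambda>x. f x + g x) (p + p') (q + q')"
proof -
  obtain f1 g1 where "f1 0 = p" "\<forall>\<^sub>F x in nhds 0. (f has_real_derivative f1 x) (at x)"
    "(f1 has_real_derivative q) (at 0)" "g1 0 = p'"
    "\<forall>\<^sub>F x in nhds 0. (g has_real_derivative g1 x) (at x)" "(g1 has_real_derivative q') (at 0)"
    using assms unfolding jet2_def by blast
  then show ?thesis unfolding jet2_def
    by (intro exI[of _ "\<lambda>x. f1 x + g1 x"])
      (auto intro: DERIV_add elim: eventually_elim2)
qed

lemma jet2_mult:
  assumes "jet2 f p q" "jet2 g p' q'"
  shows "jet2 (\<lambda>x. f x * g x) (p * g 0 + f 0 * p') (q * g 0 + 2 * p * p' + f 0 * q')"
proof -
  obtain f1 g1 where *: "f1 0 = p" "\<forall>\<^sub>F x in nhds 0. (f has_real_derivative f1 x) (at x)"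
    "(f1 has_real_derivative q) (at 0)" "g1 0 = p'"
    "\<forall>\<^sub>F x in nhds 0. (g has_real_derivative g1 x) (at x)" "(g1 has_real_derivative q') (at 0)"
    using assms unfolding jet2_def by blast
  show ?thesis unfolding jet2_def
  proof (intro exI[of _ "\<lambda>x. f1 x * g x + f x * g1 x"] conjI)
    show "\<forall>\<^sub>F x in nhds 0. ((\<lambda>x. f x * g x) has_real_derivative f1 x * g x + f x * g1 x) (at x)"
      using *(2,5) by eventually_elim (auto intro!: derivative_eq_intros)
    show "((\<lambda>x. f1 x * g x + f x * g1 x) has_real_derivative q * g 0 + 2 * p * p' + f 0 * q') (at 0)"
      using *(1,4) by (auto intro!: derivative_eq_intros *(3,6) assms[THEN jet2_DERIV])
  qed (use * in auto)
qed

lemma jet2_const: "jet2 (\<lambda>x. c) 0 0"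
  using jet2_quadratic[of c 0 0] by simp

lemma jet2_cmult: "jet2 f p q \<Longrightarrow> jet2 (\<lambda>x. c * f x) (c * p) (c * q)"
  using jet2_mult[OF jet2_const] by fastforce

lemma jet2_diff:
  assumes "jet2 f p q" "jet2 g p' q'"
  shows "jet2 (\<lambda>x. f x - g x) (p - p') (q - q')"
  using jet2_add[OF assms(1) jet2_cmult[OF assms(2), of "- 1"]] by simp

lemma jet2_compose:
  assumes "jet2 f p q" "open S" "f 0 \<in> S"
    "\<And>y. y \<in> S \<Longrightarrow> (h has_real_derivative h1 y) (at y)"
    "\<And>y. y \<in> S \<Longrightarrow> (h1 has_real_derivative h2 y) (at y)"
  shows "jet2 (\<lambda>x. h (f x)) (h1 (f 0) * p) (h2 (f 0) * p\<^sup>2 + h1 (f 0) * q)"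
proof -
  obtain f1 where *: "f1 0 = p" "\<forall>\<^sub>F x in nhds 0. (f has_real_derivative f1 x) (at x)"
    "(f1 has_real_derivative q) (at 0)"
    using assms(1) unfolding jet2_def by blast
  have f0: "(f has_real_derivative p) (at 0)" using jet2_DERIV[OF assms(1)] .
  have "isCont f 0" using f0 by (rule DERIV_isCont)
  then have "\<forall>\<^sub>F x in nhds 0. f x \<in> S"
    using assms(2,3) by (simp add: isCont_def tendsto_at_iff_tendsto_nhds topological_tendstoD)
  with *(2) have "\<forall>\<^sub>F x in nhds 0. ((\<lambda>x. h (f x)) has_real_derivative h1 (f x) * f1 x) (at x)"
    by eventually_elim (auto intro: DERIV_chain2 assms(4))
  moreover have "((\<lambda>x. h1 (f x) * f1 x) has_real_derivative (h2 (f 0) * p\<^sup>2 + h1 (f 0) * q)) (at 0)"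
    using *(1) assms(3) by (auto intro!: derivative_eq_intros DERIV_chain2[OF assms(5) f0] *(3)
        simp: power2_eq_square)
  ultimately show ?thesis unfolding jet2_def
    using *(1) by (intro exI[of _ "\<lambda>x. h1 (f x) * f1 x"]) auto
qed

lemma smooth_on_differentiable:
  assumes "smooth_on U f" "x \<in> U"
  shows "(f has_derivative frechet_derivative f (at x)) (at x)"
proof -
  have "higher_differentiable_on U f (Suc 0)" using assms(1) unfolding smooth_on_def by blast
  then show ?thesis using assms(2) by (rule higher_differentiable_on_SucD(1))
qed

lemma smooth_on_frechet_derivative:
  assumes "smooth_on U f"
  shows "smooth_on U (\<lambda>x. frechet_derivative f (at x) v)"
  using assms unfolding smooth_on_def by (metis higher_differentiable_on_SucD(2))

lemma has_derivative_along_line: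
  assumes "(f has_derivative D) (at (z + x *\<^sub>R v))"
  shows "((\<lambda>x. f (z + x *\<^sub>R v)) has_real_derivative D v) (at x)"
proof -
  have "((\<lambda>x. z + x *\<^sub>R v) has_derivative (\<lambda>h. h *\<^sub>R v)) (at x)"
    by (auto intro!: derivative_eq_intros)
  from diff_chain_at[OF this assms]
  have "((\<lambda>x. f (z + x *\<^sub>R v)) has_derivative (\<lambda>h. D (h *\<^sub>R v))) (at x)" by (simp add: o_def)
  moreover have "D (h *\<^sub>R v) = D v * h" for h
    using linear_cmul[OF has_derivative_linear[OF assms]] by simp
  ultimately show ?thesis by (simp add: has_field_derivative_def)
qed

lemma jet2_smooth:
  assumes "open U" "smooth_on U f" "z \<in> U"
  shows "jet2 (\<lambda>x. f (z + x *\<^sub>R v)) (frechet_derivative f (at z) v)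
    (frechet_derivative (\<lambda>y. frechet_derivative f (at y) v) (at z) v)"
  unfolding jet2_def
proof (intro exI[of _ "\<lambda>x. frechet_derivative f (at (z + x *\<^sub>R v)) v"] conjI)
  have "((\<lambda>x. z + x *\<^sub>R v) \<longlongrightarrow> z + 0 *\<^sub>R v) (nhds 0)"
    by (intro tendsto_intros filterlim_ident)
  then have "\<forall>\<^sub>F x in nhds 0. z + x *\<^sub>R v \<in> U"
    using assms(1,3) by (simp add: topological_tendstoD)
  then show "\<forall>\<^sub>F x in nhds 0. ((\<lambda>x. f (z + x *\<^sub>R v)) has_real_derivative
      frechet_derivative f (at (z + x *\<^sub>R v)) v) (at x)"
    by eventually_elim (intro has_derivative_along_line smooth_on_differentiable[OF assms(2)])
  show "((\<lambda>x. frechet_derivative f (at (z + x *\<^sub>R v)) v) has_real_derivative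
      frechet_derivative (\<lambda>y. frechet_derivative f (at y) v) (at z) v) (at 0)"
    by (rule has_derivative_along_line[where x = 0])
      (use smooth_on_differentiable[OF smooth_on_frechet_derivative[OF assms(2)] assms(3)] in simp)
qed simp

lemma linear_complex_vec_expand:
  fixes L :: "complex^'n::finite \<Rightarrow> real"
  assumes "linear L"
  shows "L w = (\<Sum>j\<in>UNIV. Re (w $ j) * L (axis j 1) + Im (w $ j) * L (axis j \<i>))"
proof -
  have *: "w = (\<Sum>j\<in>UNIV. Re (w $ j) *\<^sub>R axis j 1 + Im (w $ j) *\<^sub>R axis j \<i>)"
    by (simp add: vec_eq_iff axis_def complex_eq_iff if_distrib[of "\<lambda>x. _ * x"]
        if_distrib[of Re] if_distrib[of Im] sum.distrib cong: if_cong)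
  show ?thesis
    by (subst *) (simp add: linear_sum[OF assms] linear_add[OF assms] linear_cmul[OF assms])
qed

lemma levi_form_jet2:
  fixes f :: "complex^'n::finite \<Rightarrow> real"
  assumes U: "open U" "z \<in> U" and f: "smooth_on U f"
    and "jet2 (\<lambda>x. f (z + x *\<^sub>R w)) p1 q1" "jet2 (\<lambda>x. f (z + x *\<^sub>R (\<i> *s w))) p2 q2"
  shows "Re (levi_form f z w) = (q1 + q2) / 4"
proof -
  define D where "D v y = frechet_derivative f (at y) v" for v y
  define H where "H u v = frechet_derivative (D v) (at z) u" for u v
  have Dz: "(D v has_derivative (\<lambda>u. H u v)) (at z)" for v
    using smooth_on_differentiable[OF smooth_on_frechet_derivative[OF f] U(2)]
    unfolding D_def[abs_def] H_def .
  have lin1: "linear (\<lambda>u. H u v)" for v using has_derivative_linear[OF Dz] .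
  have linD: "linear (\<lambda>v. D v y)" if "y \<in> U" for y
    using has_derivative_linear[OF smooth_on_differentiable[OF f that]] unfolding D_def .
  have lin2: "linear (\<lambda>v. H u v)" for u
  proof (rule linearI)
    show "H u (a + b) = H u a + H u b" for a b
    proof -
      have "((\<lambda>y. D a y + D b y) has_derivative (\<lambda>u. H u a + H u b)) (at z)"
        by (intro has_derivative_add Dz)
      then have "(D (a + b) has_derivative (\<lambda>u. H u a + H u b)) (at z)"
        by (rule has_derivative_transform_within_open[OF _ U]) (simp add: linear_add[OF linD])
      then show ?thesis using has_derivative_unique[OF Dz] by metis
    qed
    show "H u (c *\<^sub>R a) = c *\<^sub>R H u a" for a c
    proof -
      have "((\<lambda>y. c *\<^sub>R D a y) has_derivative (\<lambda>u. c *\<^sub>R H u a)) (at z)"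
        by (intro has_derivative_scaleR_right Dz)
      then have "(D (c *\<^sub>R a) has_derivative (\<lambda>u. c *\<^sub>R H u a)) (at z)"
        by (rule has_derivative_transform_within_open[OF _ U]) (simp add: linear_cmul[OF linD])
      then show ?thesis using has_derivative_unique[OF Dz] by metis
    qed
  qed
  have q: "q1 = H w w" "q2 = H (\<i> *s w) (\<i> *s w)"
    using jet2_unique(2)[OF assms(4) jet2_smooth[OF U(1) f U(2)]]
      jet2_unique(2)[OF assms(5) jet2_smooth[OF U(1) f U(2)]]
    unfolding H_def D_def[abs_def] by auto
  have wbar: "wirtinger_bar k (\<lambda>y. complex_of_real (f y)) y =
      (of_real (D (axis k 1) y) + \<i> * of_real (D (axis k \<i>) y)) / 2" if "y \<in> U" for k y
  proof -
    have "((\<lambda>y. complex_of_real (f y)) has_derivative (\<lambda>v. of_real (D v y))) (at y)"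
      using has_derivative_of_real[OF smooth_on_differentiable[OF f that]] by (simp add: D_def)
    then show ?thesis
      unfolding wirtinger_bar_def by (simp add: frechet_derivative_at[symmetric])
  qed
  have wd: "(wirtinger_bar k (\<lambda>y. complex_of_real (f y)) has_derivative
      (\<lambda>u. (of_real (H u (axis k 1)) + \<i> * of_real (H u (axis k \<i>))) / 2)) (at z)" for k
  proof -
    have "((\<lambda>y. (of_real (D (axis k 1) y) + \<i> * of_real (D (axis k \<i>) y)) / 2) has_derivative
      (\<lambda>u. (of_real (H u (axis k 1)) + \<i> * of_real (H u (axis k \<i>))) / 2)) (at z)"
      unfolding divide_inverse
      by (intro has_derivative_mult_left has_derivative_add has_derivative_mult_right
          has_derivative_of_real Dz)
    then show ?thesis
      by (rule has_derivative_transform_within_open[OF _ U]) (simp add: wbar)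
  qed
  let ?e = "\<lambda>j. axis j 1 :: complex^'n" and ?f = "\<lambda>j. axis j \<i> :: complex^'n"
  have wir: "wirtinger j (wirtinger_bar k (\<lambda>y. complex_of_real (f y))) z =
      Complex ((H (?e j) (?e k) + H (?f j) (?f k)) / 4) ((H (?e j) (?f k) - H (?f j) (?e k)) / 4)" for j k
    unfolding wirtinger_def by (simp add: frechet_derivative_at[OF wd, symmetric] complex_eq_iff)
  have expand: "H u v = (\<Sum>j\<in>UNIV. \<Sum>k\<in>UNIV.
      Re (u $ j) * Re (v $ k) * H (?e j) (?e k) + Re (u $ j) * Im (v $ k) * H (?e j) (?f k) +
      Im (u $ j) * Re (v $ k) * H (?f j) (?e k) + Im (u $ j) * Im (v $ k) * H (?f j) (?f k))" for u v
    unfolding linear_complex_vec_expand[OF lin1[of v], of u]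
    unfolding linear_complex_vec_expand[OF lin2, of _ v]
    by (simp add: sum_distrib_left sum.distrib[symmetric] algebra_simps)
  show ?thesis
    unfolding q expand[of w w] expand[of "\<i> *s w" "\<i> *s w"] levi_form_def wir
    unfolding sum.distrib[symmetric] sum_divide_distrib Re_sum
    by (intro sum.cong refl) (simp add: field_simps)
qed

lemma strongly_psh_atI:
  fixes f :: "complex^'n::finite \<Rightarrow> real"
  assumes "open U" "z \<in> U" "smooth_on U f"
    "\<And>w. w \<noteq> 0 \<Longrightarrow> \<exists>p1 q1 p2 q2. jet2 (\<lambda>x. f (z + x *\<^sub>R w)) p1 q1 \<and>
       jet2 (\<lambda>x. f (z + x *\<^sub>R (\<i> *s w))) p2 q2 \<and> q1 + q2 > 0"
  shows "strongly_psh_at f z"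
  unfolding strongly_psh_at_def using levi_form_jet2[OF assms(1-3)] assms(4) by fastforce

lemma strongly_psh_atD:
  fixes f :: "complex^'n::finite \<Rightarrow> real"
  assumes "open U" "z \<in> U" "smooth_on U f" "strongly_psh_at f z" "w \<noteq> 0"
    "jet2 (\<lambda>x. f (z + x *\<^sub>R w)) p1 q1" "jet2 (\<lambda>x. f (z + x *\<^sub>R (\<i> *s w))) p2 q2"
  shows "q1 + q2 > 0"
  using levi_form_jet2[OF assms(1-3) assms(6,7)] assms(4,5) by (auto simp: strongly_psh_at_def)

section \<open>Line bundle metrics in a trivialization\<close>

definition join_coords :: "complex^'a::finite \<Rightarrow> complex^'b::finite \<Rightarrow> complex^('a + 'b)" where
  "join_coords x y = (\<chi> i. case i of Inl a \<Rightarrow> x $ a | Inr b \<Rightarrow> y $ b)"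

lemma coords_join [simp]: "coords1 (join_coords x y) = x" "coords2 (join_coords x y) = y"
  by (simp_all add: coords1_def coords2_def join_coords_def)

lemma coords_linear [simp]:
  "coords1 (u + v) = coords1 u + coords1 v" "coords2 (u + v) = coords2 u + coords2 v"
  "coords1 (c *\<^sub>R u) = c *\<^sub>R coords1 u" "coords2 (c *\<^sub>R u) = c *\<^sub>R coords2 u"
  "coords1 (a *s u) = a *s coords1 u" "coords2 (a *s u) = a *s coords2 u"
  by (simp_all add: coords1_def coords2_def vec_eq_iff)

lemma bounded_linear_coords:
  "bounded_linear (coords1 :: complex^('a::finite + 'b::finite) \<Rightarrow> _)"
  "bounded_linear (coords2 :: complex^('a::finite + 'b::finite) \<Rightarrow> _)"
  by (auto intro!: linear_conv_bounded_linear[THEN iffD1] linearI)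

lemma open_coords1_vimage: "open U \<Longrightarrow> open {v. coords1 v \<in> U}"
  using open_vimage[OF _ linear_continuous_on[OF bounded_linear_coords(1)]]
  by (simp add: vimage_def)

lemma coords_zeroD: "coords1 v = 0 \<Longrightarrow> coords2 v = 0 \<Longrightarrow> v = 0"
  unfolding coords1_def coords2_def vec_eq_iff by (metis vec_lambda_beta zero_index sum.exhaust)

lemma complex_vec_unit_eq_0: "(t::complex^unit) = 0 \<longleftrightarrow> t $ () = 0"
  by (simp add: vec_eq_iff)

lemma jet2_cmod_square:
  "jet2 (\<lambda>x. (cmod (a + x *\<^sub>R b))\<^sup>2) (2 * (Re a * Re b + Im a * Im b)) (2 * (cmod b)\<^sup>2)"
proof -
  have "(cmod (a + x *\<^sub>R b))\<^sup>2 =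
      (cmod a)\<^sup>2 + (2 * (Re a * Re b + Im a * Im b)) * x + (cmod b)\<^sup>2 * x\<^sup>2" for x
    unfolding cmod_power2 by (simp add: power2_eq_square algebra_simps)
  then show ?thesis using jet2_quadratic by presburger
qed

lemma jet2_norm_square:
  "jet2 (\<lambda>x. (norm (a + x *\<^sub>R b))\<^sup>2) (2 * (a \<bullet> b)) (2 * (norm b)\<^sup>2)"
proof -
  have "(norm (a + x *\<^sub>R b))\<^sup>2 = (norm a)\<^sup>2 + (2 * (a \<bullet> b)) * x + (norm b)\<^sup>2 * x\<^sup>2" for x
    unfolding power2_norm_eq_inner by (simp add: power2_eq_square algebra_simps inner_commute)
  then show ?thesis using jet2_quadratic by presburger
qed

lemma smooth_on_norm_square_linear:
  fixes L :: "'a::real_normed_vector \<Rightarrow> complex^'m::finite"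
  assumes "open U" "bounded_linear L"
  shows "smooth_on U (\<lambda>x. (norm (L x))\<^sup>2)"
proof -
  have lin: "bounded_linear (\<lambda>x. Re (L x $ i))" "bounded_linear (\<lambda>x. Im (L x $ i))" for i
    using bounded_linear_compose[OF bounded_linear_Re bounded_linear_compose[OF bounded_linear_vec_nth assms(2)]]
      bounded_linear_compose[OF bounded_linear_Im bounded_linear_compose[OF bounded_linear_vec_nth assms(2)]]
    by auto
  have "smooth_on U (\<lambda>x. \<Sum>i\<in>I. Re (L x $ i) * Re (L x $ i) + Im (L x $ i) * Im (L x $ i))"
    if "finite I" for I
    using that by induction
      (auto intro!: smooth_on_const smooth_on_add smooth_on_mult smooth_on_linear[OF _ lin(1)]
        smooth_on_linear[OF _ lin(2)] assms(1))
  from this[of UNIV] show ?thesis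
    by (simp add: norm_vec_def L2_set_def sum_nonneg cmod_power2 power2_eq_square[of "Re _"]
        power2_eq_square[of "Im _"])
qed

lemma norm_vec_scalar_mult: "norm (c *s (v :: complex^'m::finite)) = cmod c * norm v"
  by (simp add: norm_vec_def norm_mult L2_set_right_distrib)

text \<open>In the fibre direction the Levi form of \<open>|t|\<^sup>2 u\<close> is a quadratic polynomial; evaluating it at its
  minimum leaves \<open>u\<close> times the Levi form of \<open>ln u\<close>.\<close>

lemma ln_weight_strongly_psh:
  fixes u :: "complex^'d::finite \<Rightarrow> real"
  defines "f \<equiv> \<lambda>v :: complex^('d + unit). (cmod (coords2 v $ ()))\<^sup>2 * u (coords1 v)"
  assumes pos: "\<And>w. u w > 0" and smooth: "smooth_on UNIV f"
    and psh: "\<And>v. coords2 v \<noteq> 0 \<Longrightarrow> strongly_psh_at f v"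
  shows "smooth_on UNIV (\<lambda>w. ln (u w))" "strongly_psh_at (\<lambda>w. ln (u w)) w"
proof -
  have lin: "bounded_linear (\<lambda>w :: complex^'d. join_coords w (0 :: complex^unit))"
    by (auto intro!: linear_conv_bounded_linear[THEN iffD1] linearI
        simp: vec_eq_iff join_coords_def split: sum.splits)
  have "smooth_on UNIV (\<lambda>w. f (join_coords 0 (axis () 1) + join_coords w 0))"
    by (rule smooth_on_affine[OF _ _ lin _ smooth]) auto
  then have u: "smooth_on UNIV u" by (simp add: f_def axis_def)
  show ln: "smooth_on UNIV (\<lambda>w. ln (u w))"
    by (rule smooth_on_compose[OF open_UNIV smooth_on_ln u]) (use pos in simp)
  show "strongly_psh_at (\<lambda>w. ln (u w)) w"
  proof (rule strongly_psh_atI[OF open_UNIV UNIV_I ln])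
    fix \<omega> :: "complex^'d" assume "\<omega> \<noteq> 0"
    obtain p1 q1 where 1: "jet2 (\<lambda>x. u (w + x *\<^sub>R \<omega>)) p1 q1"
      using jet2_smooth[OF open_UNIV u UNIV_I] by blast
    obtain p2 q2 where 2: "jet2 (\<lambda>x. u (w + x *\<^sub>R (\<i> *s \<omega>))) p2 q2"
      using jet2_smooth[OF open_UNIV u UNIV_I] by blast
    define \<tau> where "\<tau> = Complex (- p1 / (2 * u w)) (p2 / (2 * u w))"
    define W where "W = join_coords \<omega> (axis () \<tau> :: complex^unit)"
    define z where "z = join_coords w (axis () 1 :: complex^unit)"
    have f1: "f (z + x *\<^sub>R W) = (cmod (1 + x *\<^sub>R \<tau>))\<^sup>2 * u (w + x *\<^sub>R \<omega>)"
      "f (z + x *\<^sub>R (\<i> *s W)) = (cmod (1 + x *\<^sub>R (\<i> * \<tau>)))\<^sup>2 * u (w + x *\<^sub>R (\<i> *s \<omega>))" for x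
      by (simp_all add: f_def z_def W_def axis_def)
    have "W \<noteq> 0"
      using \<open>\<omega> \<noteq> 0\<close> by (metis W_def coords_join(1) coords_linear(3) scaleR_zero_left)
    have "coords2 z \<noteq> 0" by (simp add: z_def vec_eq_iff axis_def)
    note j1 = jet2_mult[OF jet2_cmod_square[of 1 \<tau>] 1]
    note j2 = jet2_mult[OF jet2_cmod_square[of 1 "\<i> * \<tau>"] 2]
    have "(2 * (cmod \<tau>)\<^sup>2 * u w + 2 * (2 * Re \<tau>) * p1 + q1) +
       (2 * (cmod \<tau>)\<^sup>2 * u w + 2 * (- 2 * Im \<tau>) * p2 + q2) > 0"
      using strongly_psh_atD[OF open_UNIV UNIV_I smooth psh[OF \<open>coords2 z \<noteq> 0\<close>] \<open>W \<noteq> 0\<close>,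
          unfolded f1, OF j1 j2] by (simp add: norm_mult)
    moreover have "(2 * (cmod \<tau>)\<^sup>2 * u w + 2 * (2 * Re \<tau>) * p1 + q1) +
       (2 * (cmod \<tau>)\<^sup>2 * u w + 2 * (- 2 * Im \<tau>) * p2 + q2) = q1 + q2 - (p1\<^sup>2 + p2\<^sup>2) / u w"
      using pos[of w] unfolding \<tau>_def cmod_power2 by (simp add: field_simps power2_eq_square)
    ultimately have *: "q1 + q2 - (p1\<^sup>2 + p2\<^sup>2) / u w > 0" by simp
    have d: "(ln has_real_derivative inverse y) (at y)"
      "(inverse has_real_derivative - (inverse y)\<^sup>2) (at y)" if "y \<in> {0<..}" for y :: real
      using that by (auto intro!: derivative_eq_intros simp: power2_eq_square divide_inverse)
    note l1 = jet2_compose[OF 1 open_greaterThan[of 0] _ d]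
    note l2 = jet2_compose[OF 2 open_greaterThan[of 0] _ d]
    have "(- (inverse (u w))\<^sup>2 * p1\<^sup>2 + inverse (u w) * q1) +
       (- (inverse (u w))\<^sup>2 * p2\<^sup>2 + inverse (u w) * q2) =
       (q1 + q2 - (p1\<^sup>2 + p2\<^sup>2) / u w) / u w"
      using pos[of w] by (simp add: field_simps power2_eq_square)
    also have "\<dots> > 0" using * pos by simp
    finally show "\<exists>p1 q1 p2 q2. jet2 (\<lambda>x. ln (u (w + x *\<^sub>R \<omega>))) p1 q1 \<and>
       jet2 (\<lambda>x. ln (u (w + x *\<^sub>R (\<i> *s \<omega>)))) p2 q2 \<and> q1 + q2 > 0"
      using l1 l2 pos by fastforce
  qed
qed

lemma exp_weight_strongly_psh:
  fixes \<Phi> :: "complex^'n::finite \<Rightarrow> real"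
  defines "f \<equiv> \<lambda>v :: complex^('n + unit). (cmod (coords2 v $ ()))\<^sup>2 * exp (\<Phi> (coords1 v))"
  assumes U: "open U" and smooth: "smooth_on U \<Phi>" and psh: "\<And>z. z \<in> U \<Longrightarrow> strongly_psh_at \<Phi> z"
  shows "smooth_on {v. coords1 v \<in> U} f"
    "\<And>v. coords1 v \<in> U \<Longrightarrow> coords2 v \<noteq> 0 \<Longrightarrow> strongly_psh_at f v"
proof -
  let ?U = "{v :: complex^('n + unit). coords1 v \<in> U}"
  have U': "open ?U" using open_coords1_vimage[OF U] .
  have E: "smooth_on U (\<lambda>z. exp (\<Phi> z))"
    by (rule smooth_on_compose[OF U smooth_on_exp smooth]) simp
  have "smooth_on ?U (\<lambda>v. exp (\<Phi> (0 + coords1 v)))"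
    by (rule smooth_on_affine[OF U U' bounded_linear_coords(1) _ E]) auto
  moreover have "smooth_on ?U (\<lambda>v. (norm (coords2 v))\<^sup>2)"
    by (intro smooth_on_norm_square_linear U' bounded_linear_coords)
  ultimately show f: "smooth_on ?U f"
    unfolding f_def using smooth_on_mult[OF U'] by (force simp: norm_vec_def UNIV_unit)
  fix v :: "complex^('n + unit)"
  assume v: "coords1 v \<in> U" "coords2 v \<noteq> 0"
  show "strongly_psh_at f v"
  proof (rule strongly_psh_atI[OF U' _ f])
    show "v \<in> ?U" using v by simp
    fix W :: "complex^('n + unit)" assume "W \<noteq> 0"
    define z t \<omega> \<tau> where "z = coords1 v" and "t = coords2 v $ ()" and "\<omega> = coords1 W"
      and "\<tau> = coords2 W $ ()"
    have "z \<in> U" "t \<noteq> 0" using v by (auto simp: z_def t_def complex_vec_unit_eq_0)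
    define c where "c = cnj t * \<tau>"
    have c1: "2 * (Re t * Re \<tau> + Im t * Im \<tau>) = 2 * Re c"
      "2 * (Re t * Re (\<i> * \<tau>) + Im t * Im (\<i> * \<tau>)) = - 2 * Im c"
      by (simp_all add: c_def)
    have f1: "f (v + x *\<^sub>R W) = (cmod (t + x *\<^sub>R \<tau>))\<^sup>2 * exp (\<Phi> (z + x *\<^sub>R \<omega>))"
      "f (v + x *\<^sub>R (\<i> *s W)) = (cmod (t + x *\<^sub>R (\<i> * \<tau>)))\<^sup>2 * exp (\<Phi> (z + x *\<^sub>R (\<i> *s \<omega>)))" for x
      by (simp_all add: f_def z_def t_def \<omega>_def \<tau>_def)
    obtain p1 q1 where 1: "jet2 (\<lambda>x. \<Phi> (z + x *\<^sub>R \<omega>)) p1 q1"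
      using jet2_smooth[OF U smooth \<open>z \<in> U\<close>] by blast
    obtain p2 q2 where 2: "jet2 (\<lambda>x. \<Phi> (z + x *\<^sub>R (\<i> *s \<omega>))) p2 q2"
      using jet2_smooth[OF U smooth \<open>z \<in> U\<close>] by blast
    note e1 = jet2_compose[OF 1 open_UNIV UNIV_I DERIV_exp DERIV_exp]
    note e2 = jet2_compose[OF 2 open_UNIV UNIV_I DERIV_exp DERIV_exp]
    note j1 = jet2_mult[OF jet2_cmod_square[of t \<tau>] e1]
    note j2 = jet2_mult[OF jet2_cmod_square[of t "\<i> * \<tau>"] e2]
    define E where "E = exp (\<Phi> z)"
    define T where "T = (cmod t)\<^sup>2"
    have ET: "E > 0" "T > 0" using \<open>t \<noteq> 0\<close> by (auto simp: E_def T_def)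
    have cT: "(cmod \<tau>)\<^sup>2 * T = (Re c)\<^sup>2 + (Im c)\<^sup>2"
      unfolding c_def T_def cmod_power2 by (simp add: power2_eq_square algebra_simps)
    let ?Q = "(2 * (cmod \<tau>)\<^sup>2 * E + 2 * (2 * Re c) * (E * p1) + T * (E * p1\<^sup>2 + E * q1)) +
       (2 * (cmod \<tau>)\<^sup>2 * E + 2 * (- 2 * Im c) * (E * p2) + T * (E * p2\<^sup>2 + E * q2))"
    have "T * ?Q = E * (4 * ((cmod \<tau>)\<^sup>2 * T) + 4 * T * (Re c * p1 - Im c * p2) + T\<^sup>2 * (p1\<^sup>2 + p2\<^sup>2 + q1 + q2))"
      by (simp add: power2_eq_square algebra_simps)
    also have "\<dots> = E * ((2 * Re c + T * p1)\<^sup>2 + (2 * Im c - T * p2)\<^sup>2 + T\<^sup>2 * (q1 + q2))"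
      unfolding cT by (simp add: power2_eq_square algebra_simps)
    finally have Q: "T * ?Q = \<dots>" .
    have "T * ?Q > 0"
    proof (cases "\<omega> = 0")
      case False
      then have "q1 + q2 > 0"
        using strongly_psh_atD[OF U \<open>z \<in> U\<close> smooth psh[OF \<open>z \<in> U\<close>] _ 1 2] by blast
      then have "T\<^sup>2 * (q1 + q2) > 0" using ET by simp
      then show ?thesis unfolding Q using ET
        by (intro mult_pos_pos) (auto intro: add_nonneg_pos)
    next
      case True
      have "jet2 (\<lambda>x. \<Phi> z) 0 0" by (rule jet2_const)
      then have "p1 = 0" "q1 = 0" "p2 = 0" "q2 = 0"
        using jet2_unique 1 2 True by (force simp: vec_eq_iff)+
      moreover have "c \<noteq> 0"
        using \<open>t \<noteq> 0\<close> True \<open>W \<noteq> 0\<close> coords_zeroD[of W]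
        by (auto simp: c_def \<omega>_def \<tau>_def complex_vec_unit_eq_0)
      then have "(Re c)\<^sup>2 + (Im c)\<^sup>2 > 0" by (simp add: cmod_power2[symmetric])
      ultimately show ?thesis unfolding Q using ET by (simp add: power_mult_distrib)
    qed
    then have "?Q > 0" using ET zero_less_mult_pos by blast
    then show "\<exists>p1 q1 p2 q2. jet2 (\<lambda>x. f (v + x *\<^sub>R W)) p1 q1 \<and>
       jet2 (\<lambda>x. f (v + x *\<^sub>R (\<i> *s W))) p2 q2 \<and> q1 + q2 > 0"
      using j1 j2 unfolding f1 c1 by (force simp: norm_mult E_def T_def)
  qed
qed

lemma add_norm_square_strongly_psh:
  fixes \<phi> :: "complex^'d::finite \<Rightarrow> real" and A \<sigma> :: real
  defines "\<Psi> \<equiv> \<lambda>z :: complex^('m::finite + 'd). \<phi> (coords2 z) + A * ((norm (coords1 z))\<^sup>2 - \<sigma>)"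
  assumes "A > 0" and smooth: "smooth_on UNIV \<phi>" and psh: "\<And>w. strongly_psh_at \<phi> w"
  shows "smooth_on UNIV \<Psi>" "strongly_psh_at \<Psi> z"
proof -
  have "smooth_on UNIV (\<lambda>z :: complex^('m + 'd). \<phi> (0 + coords2 z))"
    by (rule smooth_on_affine[OF _ _ bounded_linear_coords(2) _ smooth]) auto
  moreover have "smooth_on UNIV (\<lambda>z :: complex^('m + 'd). (norm (coords1 z))\<^sup>2)"
    by (intro smooth_on_norm_square_linear bounded_linear_coords) auto
  ultimately show \<Psi>: "smooth_on UNIV \<Psi>"
    unfolding \<Psi>_def by (auto intro!: smooth_intros)
  show "strongly_psh_at \<Psi> z"
  proof (rule strongly_psh_atI[OF open_UNIV UNIV_I \<Psi>])
    fix W :: "complex^('m + 'd)" assume W: "W \<noteq> 0"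
    define s w \<zeta> \<omega> where "s = coords1 z" and "w = coords2 z" and "\<zeta> = coords1 W" and "\<omega> = coords2 W"
    obtain p1 q1 where 1: "jet2 (\<lambda>x. \<phi> (w + x *\<^sub>R \<omega>)) p1 q1"
      using jet2_smooth[OF open_UNIV smooth UNIV_I] by blast
    obtain p2 q2 where 2: "jet2 (\<lambda>x. \<phi> (w + x *\<^sub>R (\<i> *s \<omega>))) p2 q2"
      using jet2_smooth[OF open_UNIV smooth UNIV_I] by blast
    have N: "jet2 (\<lambda>x. A * ((norm (s + x *\<^sub>R y))\<^sup>2 - \<sigma>)) (A * (2 * (s \<bullet> y))) (A * (2 * (norm y)\<^sup>2))" for y
      using jet2_cmult[OF jet2_diff[OF jet2_norm_square jet2_const[of \<sigma>]], of A s y] by simp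
    have "(q1 + A * (2 * (norm \<zeta>)\<^sup>2)) + (q2 + A * (2 * (norm (\<i> *s \<zeta>))\<^sup>2)) > 0"
    proof (cases "\<omega> = 0")
      case False
      then have "q1 + q2 > 0"
        using strongly_psh_atD[OF open_UNIV UNIV_I smooth psh _ 1 2] by blast
      moreover have "A * (norm \<zeta>)\<^sup>2 \<ge> 0" using \<open>A > 0\<close> by simp
      ultimately show ?thesis by (simp add: norm_vec_scalar_mult)
    next
      case True
      have "jet2 (\<lambda>x. \<phi> w) 0 0" by (rule jet2_const)
      then have "q1 = 0" "q2 = 0" using jet2_unique 1 2 True by (force simp: vec_eq_iff)+
      moreover have "\<zeta> \<noteq> 0" using W True coords_zeroD[of W] by (auto simp: \<zeta>_def \<omega>_def)
      ultimately show ?thesis using \<open>A > 0\<close> by (simp add: norm_vec_scalar_mult)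
    qed
    then show "\<exists>p1 q1 p2 q2. jet2 (\<lambda>x. \<Psi> (z + x *\<^sub>R W)) p1 q1 \<and>
       jet2 (\<lambda>x. \<Psi> (z + x *\<^sub>R (\<i> *s W))) p2 q2 \<and> q1 + q2 > 0"
      using jet2_add[OF 1 N[of \<zeta>]] jet2_add[OF 2 N[of "\<i> *s \<zeta>"]]
      unfolding \<Psi>_def s_def w_def \<zeta>_def \<omega>_def by fastforce
  qed
qed

lemma regularized_max_strongly_psh:
  fixes f g :: "complex^'n::finite \<Rightarrow> real" and \<theta> \<theta>1 \<theta>2 :: "real \<Rightarrow> real"
  defines "M \<equiv> \<lambda>z. g z + \<theta> (f z - g z)"
  assumes smooth: "smooth_on UNIV f" "smooth_on UNIV g" "smooth_on UNIV \<theta>"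
    and d0: "\<And>x. (\<theta> has_real_derivative \<theta>1 x) (at x)" and d1: "\<And>x. (\<theta>1 has_real_derivative \<theta>2 x) (at x)"
    and b: "\<And>x. 0 \<le> \<theta>1 x \<and> \<theta>1 x \<le> 1 \<and> 0 \<le> \<theta>2 x"
    and psh: "\<And>z. strongly_psh_at f z" "\<And>z. strongly_psh_at g z"
  shows "smooth_on UNIV M" "strongly_psh_at M z"
proof -
  have "smooth_on UNIV (\<lambda>z. \<theta> (f z - g z))"
    by (rule smooth_on_compose[OF _ smooth(3)]) (auto intro!: smooth_intros smooth)
  then show M: "smooth_on UNIV M"
    unfolding M_def using smooth by (auto intro!: smooth_intros)
  show "strongly_psh_at M z"
  proof (rule strongly_psh_atI[OF open_UNIV UNIV_I M])
    fix w :: "complex^'n" assume w: "w \<noteq> 0"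
    have ex: "\<exists>p q. jet2 (\<lambda>x. h (z + x *\<^sub>R v)) p q" if "smooth_on UNIV h" for h v
      using jet2_smooth[OF open_UNIV that UNIV_I] by blast
    obtain p1 q1 p2 q2 where f: "jet2 (\<lambda>x. f (z + x *\<^sub>R w)) p1 q1"
      "jet2 (\<lambda>x. f (z + x *\<^sub>R (\<i> *s w))) p2 q2" using ex smooth(1) by blast
    obtain p3 q3 p4 q4 where g: "jet2 (\<lambda>x. g (z + x *\<^sub>R w)) p3 q3"
      "jet2 (\<lambda>x. g (z + x *\<^sub>R (\<i> *s w))) p4 q4" using ex smooth(2) by blast
    have comp: "jet2 (\<lambda>x. k x + \<theta> (h x - k x)) (p' + \<theta>1 (h 0 - k 0) * (p - p'))
        (q' + (\<theta>2 (h 0 - k 0) * (p - p')\<^sup>2 + \<theta>1 (h 0 - k 0) * (q - q')))"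
      if "jet2 h p q" "jet2 k p' q'" for h k p q p' q'
      using jet2_add[OF that(2) jet2_compose[OF jet2_diff[OF that] open_UNIV UNIV_I d0 d1]] .
    note m1 = comp[OF f(1) g(1)] and m2 = comp[OF f(2) g(2)]
    define a1 a2 where "a1 = \<theta>1 (f z - g z)" and "a2 = \<theta>2 (f z - g z)"
    have a: "0 \<le> a1" "a1 \<le> 1" "0 \<le> a2" using b by (auto simp: a1_def a2_def)
    have F: "q1 + q2 > 0" using strongly_psh_atD[OF open_UNIV UNIV_I smooth(1) psh(1) w f] .
    have G: "q3 + q4 > 0" using strongly_psh_atD[OF open_UNIV UNIV_I smooth(2) psh(2) w g] .
    have "(q3 + (a2 * (p1 - p3)\<^sup>2 + a1 * (q1 - q3))) + (q4 + (a2 * (p2 - p4)\<^sup>2 + a1 * (q2 - q4)))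
      = a1 * (q1 + q2) + (1 - a1) * (q3 + q4) + a2 * ((p1 - p3)\<^sup>2 + (p2 - p4)\<^sup>2)"
      by (simp add: algebra_simps)
    also have "\<dots> > 0"
    proof -
      have "a1 * (q1 + q2) + (1 - a1) * (q3 + q4) > 0"
        using a F G by (cases "a1 = 0") (auto intro!: add_pos_nonneg)
      moreover have "a2 * ((p1 - p3)\<^sup>2 + (p2 - p4)\<^sup>2) \<ge> 0" using a by simp
      ultimately show ?thesis by linarith
    qed
    finally show "\<exists>p1 q1 p2 q2. jet2 (\<lambda>x. M (z + x *\<^sub>R w)) p1 q1 \<and>
       jet2 (\<lambda>x. M (z + x *\<^sub>R (\<i> *s w))) p2 q2 \<and> q1 + q2 > 0"
      using m1 m2 unfolding M_def a1_def a2_def by fastforce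
  qed
qed

section \<open>Metrics on holomorphic line bundles\<close>

definition line_triv ::
    "('p, 'e, 'd::finite, unit) hol_bundle \<Rightarrow> 'p \<Rightarrow> (complex^unit \<Rightarrow> 'e) \<Rightarrow> bool" where
  "line_triv E p \<tau> \<longleftrightarrow> bij_betw \<tau> UNIV (fibre E p) \<and>
     (\<forall>s t. fadd E p (\<tau> s) (\<tau> t) = \<tau> (s + t)) \<and> (\<forall>c t. fscale E p c (\<tau> t) = \<tau> (c *s t)) \<and>
     fzero E p = \<tau> 0"

lemma line_trivD:
  assumes "line_triv E p \<tau>"
  shows "inj \<tau>" "fibre E p = range \<tau>" "fadd E p (\<tau> s) (\<tau> t) = \<tau> (s + t)"
    "fscale E p c (\<tau> t) = \<tau> (c *s t)" "fzero E p = \<tau> 0"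
  using assms by (auto simp: line_triv_def bij_betw_def)

lemma smult_one_unit: "t $ () *s 1 = (t :: complex^unit)"
  by (simp add: vec_eq_iff)

lemma hermitian_form_on_line:
  assumes "line_triv E p \<tau>" "hermitian_form_on E p H" "pos_def_on E p H"
    "\<And>x. x \<in> fibre E p \<Longrightarrow> complex_of_real (h (p, x)) = H x x"
  shows "h (p, \<tau> t) = (cmod (t $ ()))\<^sup>2 * h (p, \<tau> 1)" "h (p, \<tau> 1) > 0"
proof -
  note \<tau> = line_trivD[OF assms(1)]
  let ?e = "\<tau> 1" and ?c = "t $ ()"
  have e: "?e \<in> fibre E p" by (simp add: \<tau>)
  have t: "\<tau> t = fscale E p ?c ?e" by (simp only: \<tau>(4) smult_one_unit)
  have tf: "\<tau> t \<in> fibre E p" by (simp add: \<tau>)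
  have scale: "H (fscale E p c x) y = c * H x y" if "x \<in> fibre E p" "y \<in> fibre E p" for c x y
    using assms(2) that unfolding hermitian_form_on_def by blast
  have swap: "H y x = cnj (H x y)" if "x \<in> fibre E p" "y \<in> fibre E p" for x y
    using assms(2) that unfolding hermitian_form_on_def by blast
  have "H (\<tau> t) (\<tau> t) = ?c * H ?e (\<tau> t)"
    using scale[OF e tf, of ?c] by (simp add: t)
  also have "H ?e (\<tau> t) = cnj (?c * H ?e ?e)"
    using swap[OF tf e] scale[OF e e, of ?c] by (simp add: t)
  finally have "complex_of_real (h (p, \<tau> t)) = complex_of_real ((cmod ?c)\<^sup>2 * h (p, ?e))"
    using assms(4)[OF e, symmetric] assms(4)[OF tf]
    by (simp add: complex_norm_square algebra_simps del: of_real_power)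
  then show "h (p, \<tau> t) = (cmod ?c)\<^sup>2 * h (p, ?e)" by (simp only: of_real_eq_iff)
  have "(1 :: complex^unit) \<noteq> 0" by (simp add: vec_eq_iff)
  then have "?e \<noteq> fzero E p" using \<tau>(1,5) by (auto dest: injD)
  then have "Re (H ?e ?e) > 0" using assms(3) e by (auto simp: pos_def_on_def)
  then show "h (p, ?e) > 0" using assms(4)[OF e] by (metis Re_complex_of_real)
qed

lemma is_metric_line:
  assumes "line_triv E p \<tau>" "is_metric E h" "p \<in> base E"
  shows "h (p, \<tau> t) = (cmod (t $ ()))\<^sup>2 * h (p, \<tau> 1)" "h (p, \<tau> 1) > 0"
proof -
  obtain H where "hermitian_form_on E p H" "pos_def_on E p H"
    "\<And>x. x \<in> fibre E p \<Longrightarrow> complex_of_real (h (p, x)) = H x x"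
    using assms(2,3) unfolding is_metric_def by blast
  from hermitian_form_on_line[OF assms(1) this]
  show "h (p, \<tau> t) = (cmod (t $ ()))\<^sup>2 * h (p, \<tau> 1)" "h (p, \<tau> 1) > 0" by blast+
qed

lemma fibre_dual_line:
  assumes "line_triv E p \<tau>" "\<phi> \<in> fibre_dual E p"
  shows "\<phi> (\<tau> t) = t $ () * \<phi> (\<tau> 1)"
proof -
  note \<tau> = line_trivD[OF assms(1)]
  have "\<phi> (\<tau> t) = \<phi> (fscale E p (t $ ()) (\<tau> 1))"
    by (simp only: \<tau>(4) smult_one_unit)
  also have "\<dots> = t $ () * \<phi> (\<tau> 1)"
    using assms(2) by (simp add: fibre_dual_def \<tau>(2))
  finally show ?thesis .
qed

lemma dual_metric_line:
  assumes "line_triv E p \<tau>" "\<And>t. h (p, \<tau> t) = (cmod (t $ ()))\<^sup>2 * a" "\<phi> \<in> fibre_dual E p"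
  shows "dual_metric E h (p, \<phi>) = (cmod (\<phi> (\<tau> 1)))\<^sup>2 / a"
proof -
  note \<tau> = line_trivD[OF assms(1)]
  let ?S = "fibre E p - {fzero E p}"
  have "(1 :: complex^unit) \<noteq> 0" by (simp add: vec_eq_iff)
  then have "\<tau> 1 \<in> ?S" using \<tau>(1,2,5) by (auto dest: injD)
  have const: "(cmod (\<phi> x))\<^sup>2 / h (p, x) = (cmod (\<phi> (\<tau> 1)))\<^sup>2 / a" if "x \<in> ?S" for x
  proof -
    obtain t where t: "x = \<tau> t" "t \<noteq> 0" using \<open>x \<in> ?S\<close> \<tau> by auto
    then have "t $ () \<noteq> 0" by (simp add: complex_vec_unit_eq_0)
    then show ?thesis
      unfolding t assms(2) fibre_dual_line[OF assms(1,3), of t]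
      by (simp add: norm_mult power_mult_distrib)
  qed
  then show ?thesis
    using \<open>\<tau> 1 \<in> ?S\<close> unfolding dual_metric_def prod.case
    by (subst SUP_cong[OF refl const]) (auto intro: cSUP_const)
qed

lemma dual_triv_line:
  assumes "line_triv E (x z) (\<tau> z)"
  shows "dual_triv E x \<tau> z t \<in> fibre_dual E (x z)" "dual_triv E x \<tau> z t (\<tau> z 1) = t $ ()"
proof -
  note \<tau> = line_trivD[OF assms]
  have val: "dual_triv E x \<tau> z t (\<tau> z s) = t $ () * s $ ()" for s
    by (simp add: dual_triv_def \<tau>(1,2) UNIV_unit)
  then show "dual_triv E x \<tau> z t (\<tau> z 1) = t $ ()" by simp
  have "dual_triv E x \<tau> z t \<in> extensional (fibre E (x z))" by (simp add: dual_triv_def)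
  then show "dual_triv E x \<tau> z t \<in> fibre_dual E (x z)"
    using val \<tau>(2,3,4) by (auto simp: fibre_dual_def algebra_simps)
qed

lemma dual_metric_dual_triv:
  assumes "line_triv E (x z) (\<tau> z)" "\<And>t. h (x z, \<tau> z t) = (cmod (t $ ()))\<^sup>2 * a"
  shows "dual_metric E h (x z, dual_triv E x \<tau> z t) = (cmod (t $ ()))\<^sup>2 / a"
  using dual_metric_line[OF assms dual_triv_line(1)[of E x z \<tau>, OF assms(1)]]
    dual_triv_line(2)[of E x z \<tau>, OF assms(1)] by simp

lemma is_metric_dual_line:
  assumes "\<And>p. p \<in> base E \<Longrightarrow> \<exists>\<tau>. line_triv E p \<tau>" "is_metric E h"
  shows "is_metric (dual_bundle E) (dual_metric E h)"
  unfolding is_metric_def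
proof
  fix p assume "p \<in> base (dual_bundle E)"
  then have p: "p \<in> base E" by (simp add: dual_bundle_def)
  then obtain \<tau> where triv: "line_triv E p \<tau>" using assms(1) by blast
  note \<tau> = line_trivD[OF triv]
  define a where "a = h (p, \<tau> 1)"
  have a: "a > 0" "\<And>t. h (p, \<tau> t) = (cmod (t $ ()))\<^sup>2 * a"
    using is_metric_line[OF triv assms(2) p] unfolding a_def by blast+
  define H where "H \<phi> \<psi> = \<phi> (\<tau> 1) * cnj (\<psi> (\<tau> 1)) / complex_of_real a" for \<phi> \<psi> :: "_ \<Rightarrow> complex"
  have e: "\<tau> 1 \<in> fibre E p" by (simp add: \<tau>)
  have fib: "fibre (dual_bundle E) p = fibre_dual E p" by (simp add: dual_bundle_def)
  show "\<exists>H. hermitian_form_on (dual_bundle E) p H \<and> pos_def_on (dual_bundle E) p H \<and>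
      (\<forall>\<phi>\<in>fibre (dual_bundle E) p. complex_of_real (dual_metric E h (p, \<phi>)) = H \<phi> \<phi>)"
  proof (intro exI[of _ H] conjI ballI)
    show "hermitian_form_on (dual_bundle E) p H"
      unfolding hermitian_form_on_def dual_bundle_def using e
      by (auto simp: H_def field_simps add_divide_distrib)
    have eq: "complex_of_real (dual_metric E h (p, \<phi>)) = H \<phi> \<phi>" "Re (H \<phi> \<phi>) = (cmod (\<phi> (\<tau> 1)))\<^sup>2 / a"
      if "\<phi> \<in> fibre_dual E p" for \<phi>
    proof -
      have "H \<phi> \<phi> = complex_of_real ((cmod (\<phi> (\<tau> 1)))\<^sup>2 / a)"
        by (simp add: H_def complex_norm_square del: of_real_power)
      then show "complex_of_real (dual_metric E h (p, \<phi>)) = H \<phi> \<phi>"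
        "Re (H \<phi> \<phi>) = (cmod (\<phi> (\<tau> 1)))\<^sup>2 / a"
        by (simp_all add: dual_metric_line[where h = h, OF triv a(2) that] del: of_real_power)
    qed
    show "complex_of_real (dual_metric E h (p, \<phi>)) = H \<phi> \<phi>" if "\<phi> \<in> fibre (dual_bundle E) p" for \<phi>
      using eq that fib by blast
    show "pos_def_on (dual_bundle E) p H"
      unfolding pos_def_on_def fib
    proof (intro ballI impI)
      fix \<phi> assume \<phi>: "\<phi> \<in> fibre_dual E p" "\<phi> \<noteq> fzero (dual_bundle E) p"
      have "\<phi> (\<tau> 1) \<noteq> 0"
      proof
        assume "\<phi> (\<tau> 1) = 0"
        then have "\<phi> (\<tau> t) = 0" for t using fibre_dual_line[OF triv \<phi>(1), of t] by simp
        then have "\<phi> = restrict (\<lambda>x. 0) (fibre E p)"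
          using \<phi>(1) by (auto simp: fibre_dual_def fun_eq_iff restrict_def extensional_def \<tau>(2))
        with \<phi>(2) show False by (simp add: dual_bundle_def)
      qed
      then show "Re (H \<phi> \<phi>) > 0" using a(1) eq(2)[OF \<phi>(1)] by simp
    qed
  qed
qed

text \<open>In a trivialization a metric is \<open>|t|\<^sup>2 exp (- \<Phi>)\<close>, and its dual \<open>|t|\<^sup>2 exp \<Phi>\<close>.\<close>

lemma positively_curved_lineI:
  assumes "is_metric E h" "\<And>p. p \<in> base E \<Longrightarrow> \<exists>\<tau>. line_triv E p \<tau>"
    "\<And>U x \<tau>. (U, x, \<tau>) \<in> trivs E \<Longrightarrow> \<exists>\<Phi>. open U \<and> smooth_on U \<Phi> \<and> (\<forall>z\<in>U. strongly_psh_at \<Phi> z) \<and>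
       (\<forall>z. line_triv E (x z) (\<tau> z) \<and> (\<forall>t. h (x z, \<tau> z t) = (cmod (t $ ()))\<^sup>2 * exp (- \<Phi> z)))"
  shows "positively_curved E h"
proof -
  have "smooth_on {v. coords1 v \<in> U} (\<lambda>v. dual_metric E h (total_param x (dual_triv E x \<tau>) v)) \<and>
     (\<forall>v. coords1 v \<in> U \<and> coords2 v \<noteq> 0 \<longrightarrow>
        strongly_psh_at (\<lambda>v. dual_metric E h (total_param x (dual_triv E x \<tau>) v)) v)"
    if mem: "(U, x, \<tau>) \<in> trivs E" for U x \<tau>
  proof -
    obtain \<Phi> where \<Phi>: "open U" "smooth_on U \<Phi>" "\<And>z. z \<in> U \<Longrightarrow> strongly_psh_at \<Phi> z"
      and triv: "\<And>z. line_triv E (x z) (\<tau> z)"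
      and h: "\<And>z t. h (x z, \<tau> z t) = (cmod (t $ ()))\<^sup>2 * exp (- \<Phi> z)"
      using assms(3)[OF mem] by blast
    have "dual_metric E h (total_param x (dual_triv E x \<tau>) v) =
        (cmod (coords2 v $ ()))\<^sup>2 * exp (\<Phi> (coords1 v))" for v
      using dual_metric_dual_triv[of E x "coords1 v" \<tau> h, OF triv h]
      by (simp add: total_param_def exp_minus field_simps)
    then show ?thesis using exp_weight_strongly_psh[OF \<Phi>] by simp
  qed
  then show ?thesis
    unfolding positively_curved_def negatively_curved_def smooth_on_total_def strongly_psh_off_zero_def
    using assms(1) is_metric_dual_line[OF assms(2,1)]
    by (fastforce simp: dual_bundle_def)
qed

lemma positively_curved_lineD:
  assumes "positively_curved E h" "(UNIV, x, \<tau>) \<in> trivs E"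
    "\<And>z. x z \<in> base E" "\<And>z. line_triv E (x z) (\<tau> z)"
  shows "smooth_on UNIV (\<lambda>z. - ln (h (x z, \<tau> z 1)))" "strongly_psh_at (\<lambda>z. - ln (h (x z, \<tau> z 1))) z"
proof -
  have met: "is_metric E h" using assms(1) by (simp add: positively_curved_def)
  note h = is_metric_line[OF assms(4) met assms(3)]
  define u where "u z = 1 / h (x z, \<tau> z 1)" for z
  have u: "u z > 0" for z using h(2) by (simp add: u_def)
  have ln: "ln (u z) = - ln (h (x z, \<tau> z 1))" for z using h(2)[of z] by (simp add: u_def ln_div)
  have eq: "dual_metric E h (total_param x (dual_triv E x \<tau>) v) =
      (cmod (coords2 v $ ()))\<^sup>2 * u (coords1 v)" for v
    using dual_metric_dual_triv[of E x "coords1 v" \<tau> h, OF assms(4) h(1)]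
    by (simp add: total_param_def u_def)
  have "smooth_on UNIV (\<lambda>v. dual_metric E h (total_param x (dual_triv E x \<tau>) v))"
    "\<And>v. coords2 v \<noteq> 0 \<Longrightarrow>
       strongly_psh_at (\<lambda>v. dual_metric E h (total_param x (dual_triv E x \<tau>) v)) v"
    using assms(1,2)
    unfolding positively_curved_def negatively_curved_def smooth_on_total_def strongly_psh_off_zero_def
    by (force simp: dual_bundle_def)+
  from ln_weight_strongly_psh[of u, OF u this[unfolded eq]]
  show "smooth_on UNIV (\<lambda>z. - ln (h (x z, \<tau> z 1)))" "strongly_psh_at (\<lambda>z. - ln (h (x z, \<tau> z 1))) z"
    by (simp_all add: ln)
qed

section \<open>Affine charts on the space of hyperplanes\<close>

locale basis_chart = vector_space sc
  for sc :: "complex \<Rightarrow> 'v::ab_group_add \<Rightarrow> 'v" +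
  fixes b :: "'d::finite option \<Rightarrow> 'v"
  assumes is_basis: "is_basis sc b"
begin

lemma inj_basis: "inj b" and indep: "independent (range b)" and span_basis: "span (range b) = UNIV"
  using is_basis by (auto simp: is_basis_def)

sublocale finite_dimensional_vector_space sc "range b"
  by unfold_locales (auto simp: indep span_basis)

lemma basis_swap: "is_basis sc (b \<circ> Transposition.transpose None i)"
proof -
  have "range (b \<circ> Transposition.transpose None i) = range b"
    by (metis bij_is_surj bij_swap_iff bij_transpose image_comp)
  moreover have "inj (b \<circ> Transposition.transpose None i)"
    using inj_basis by (simp add: inj_compose)
  ultimately show ?thesis using is_basis by (simp add: is_basis_def)
qed

lemma functional_expand:
  assumes "\<And>u v. \<eta> (u + v) = \<eta> u + \<eta> v" "\<And>c v. \<eta> (sc c v) = c * \<eta> v"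
  shows "\<eta> v = (\<Sum>k\<in>UNIV. representation (range b) v (b k) * \<eta> (b k))"
proof -
  have \<eta>0: "\<eta> 0 = 0" using assms(2)[of 0 0] by simp
  have sum: "\<eta> (\<Sum>x\<in>A. g x) = (\<Sum>x\<in>A. \<eta> (g x))" if "finite A" for A and g :: "'v \<Rightarrow> 'v"
    using that by induction (auto simp: assms(1) \<eta>0)
  have "(\<Sum>x\<in>range b. sc (representation (range b) v x) x) = v"
    by (rule sum_representation_eq) (auto simp: indep span_basis)
  then have "\<eta> v = \<eta> (\<Sum>x\<in>range b. sc (representation (range b) v x) x)" by simp
  also have "\<dots> = (\<Sum>x\<in>range b. representation (range b) v x * \<eta> x)" by (simp add: sum assms(2))
  also have "\<dots> = (\<Sum>k\<in>UNIV. representation (range b) v (b k) * \<eta> (b k))"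
    by (simp add: sum.reindex[OF inj_basis])
  finally show ?thesis .
qed

lemma chart_functional_linear:
  "chart_functional sc b w (u + v) = chart_functional sc b w u + chart_functional sc b w v"
  "chart_functional sc b w (sc c v) = c * chart_functional sc b w v"
  "chart_functional sc b w (b None) = 1"
  by (simp_all add: chart_functional_def representation_add representation_scale representation_basis
      indep span_basis sum.distrib sum_distrib_left algebra_simps inj_eq[OF inj_basis])

lemma chart_functional_0: "chart_functional sc b w 0 = 0"
  using chart_functional_linear(2)[of w 0 0] by simp

lemma chart_functional_minus: "chart_functional sc b w (u - v) = chart_functional sc b w u - chart_functional sc b w v"
  using chart_functional_linear(1)[of w "u - v" v] by simp

lemma chart_functional_eq:
  assumes "\<And>u v. \<eta> (u + v) = \<eta> u + \<eta> v" "\<And>c v. \<eta> (sc c v) = c * \<eta> v" "\<eta> (b None) = 1"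
  shows "\<eta> = chart_functional sc b (\<chi> i. \<eta> (b (Some i)))"
proof
  show "\<eta> v = chart_functional sc b (\<chi> i. \<eta> (b (Some i))) v" for v
    using functional_expand[of \<eta> v, OF assms(1,2)]
    by (simp add: chart_functional_def UNIV_option_conv sum.reindex assms(3) mult.commute)
qed

lemma chart_coset_add:
  "quot_add P (chart_coset sc b w s) (chart_coset sc b w t) = chart_coset sc b w (s + t)"
proof -
  have "\<exists>u v. x = u + v \<and> chart_functional sc b w u = s $ () \<and> chart_functional sc b w v = t $ ()"
    if "chart_functional sc b w x = s $ () + t $ ()" for x
    by (rule exI[of _ "sc (s $ ()) (b None)"], rule exI[of _ "x - sc (s $ ()) (b None)"])
      (simp add: that chart_functional_minus chart_functional_linear)
  then show ?thesis
    by (auto simp: quot_add_def chart_coset_def chart_functional_linear)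
qed

lemma chart_coset_scale:
  "quot_scale sc (chart_hyperplane sc b w) c (chart_coset sc b w t) = chart_coset sc b w (c *s t)"
proof -
  have "\<exists>u p. x = sc c u + p \<and> chart_functional sc b w u = t $ () \<and> chart_functional sc b w p = 0"
    if "chart_functional sc b w x = c * t $ ()" for x
    by (rule exI[of _ "sc (t $ ()) (b None)"], rule exI[of _ "x - sc c (sc (t $ ()) (b None))"])
      (simp add: that chart_functional_minus chart_functional_linear del: scale_scale)
  then show ?thesis
    by (auto simp: quot_scale_def chart_coset_def chart_hyperplane_def chart_functional_linear)
qed

lemma chart_coset_0: "chart_coset sc b w 0 = chart_hyperplane sc b w"
  by (simp add: chart_coset_def chart_hyperplane_def)

lemma chart_coset_bij: "bij_betw (chart_coset sc b w) UNIV (quot (chart_hyperplane sc b w))"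
proof -
  have e: "chart_functional sc b w (sc c (b None)) = c" for c
    by (simp add: chart_functional_linear)
  have "inj (chart_coset sc b w)"
  proof (rule injI)
    fix s t assume "chart_coset sc b w s = chart_coset sc b w t"
    then have "sc (s $ ()) (b None) \<in> chart_coset sc b w t"
      using e[of "s $ ()"] by (auto simp: chart_coset_def)
    then show "s = t" by (simp add: chart_coset_def e vec_eq_iff)
  qed
  moreover have coset: "(+) v ` chart_hyperplane sc b w = chart_coset sc b w (axis () (chart_functional sc b w v))" for v
  proof -
    have "x \<in> (+) v ` chart_hyperplane sc b w" if "chart_functional sc b w x = chart_functional sc b w v" for x
      by (rule image_eqI[of _ _ "x - v"]) (simp_all add: chart_hyperplane_def chart_functional_minus that)
    then show ?thesis
      by (auto simp: chart_coset_def chart_hyperplane_def axis_def chart_functional_linear)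
  qed
  have "chart_coset sc b w t \<in> quot (chart_hyperplane sc b w)" for t
  proof -
    have "t = axis () (chart_functional sc b w (sc (t $ ()) (b None)))"
      by (simp add: e vec_eq_iff axis_def)
    then show ?thesis unfolding quot_def using coset by (metis rangeI)
  qed
  then have "range (chart_coset sc b w) = quot (chart_hyperplane sc b w)"
    using coset by (auto simp: quot_def)
  ultimately show ?thesis by (simp add: bij_betw_def)
qed

lemma line_triv_O1_PV:
  "line_triv (O1_PV sc :: ('v set, 'v set, 'd, unit) hol_bundle)
     (chart_hyperplane sc b w) (chart_coset sc b w)"
  by (simp add: line_triv_def O1_PV_def chart_coset_bij chart_coset_add chart_coset_scale chart_coset_0)

lemma line_triv_O1_PF:
  "line_triv (O1_PF B sc :: ((complex^'m::finite) \<times> 'v set, 'v set, 'm + 'd, unit) hol_bundle)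
     (s, chart_hyperplane sc b w) (chart_coset sc b w)"
  by (simp add: line_triv_def O1_PF_def chart_coset_bij chart_coset_add chart_coset_scale chart_coset_0)

lemma chart_hyperplane_in_hyperplanes: "chart_hyperplane sc b w \<in> hyperplanes sc"
proof -
  let ?P = "chart_hyperplane sc b w" and ?n = "b None"
  have sub: "subspace ?P"
    by (auto simp: subspace_def chart_hyperplane_def chart_functional_linear chart_functional_0)
  obtain C where C: "C \<subseteq> ?P" "independent C" "?P \<subseteq> span C" "card C = dim ?P"
    using basis_exists by blast
  have spanC: "span C = ?P" using C sub by (metis span_eq_iff span_mono subset_antisym)
  have "?n \<notin> span C" by (simp add: spanC chart_hyperplane_def chart_functional_linear)
  then have ind: "independent (insert ?n C)" "?n \<notin> C"
    using C(2) by (auto simp: independent_insert span_base)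
  have "v \<in> span (insert ?n C)" for v
  proof -
    have "v - sc (chart_functional sc b w v) ?n \<in> span C"
      by (simp add: spanC chart_hyperplane_def chart_functional_minus chart_functional_linear)
    then show ?thesis by (auto simp: span_insert)
  qed
  then have "dim (UNIV :: 'v set) = card (insert ?n C)"
    using ind(1) by (intro dim_unique) auto
  then have "dim ?P + 1 = dim (UNIV :: 'v set)"
    using C(4) ind(2) finiteI_independent[OF C(2)] by simp
  with sub show ?thesis by (simp add: hyperplanes_def)
qed

lemma hyperplane_functional:
  assumes "P \<in> hyperplanes sc"
  obtains \<eta> :: "'v \<Rightarrow> complex" where "\<And>u v. \<eta> (u + v) = \<eta> u + \<eta> v" "\<And>c v. \<eta> (sc c v) = c * \<eta> v"
    "P = {v. \<eta> v = 0}" "\<exists>v. \<eta> v \<noteq> 0"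
proof -
  have sub: "subspace P" and dimP: "dim P + 1 = dim (UNIV :: 'v set)"
    using assms by (auto simp: hyperplanes_def)
  obtain C where C: "C \<subseteq> P" "independent C" "P \<subseteq> span C" "card C = dim P"
    using basis_exists by blast
  have spanC: "span C = P" using C sub by (metis span_eq_iff span_mono subset_antisym)
  have "P \<noteq> UNIV" using dimP by auto
  then obtain n where n: "n \<notin> P" by blast
  then have ind: "independent (insert n C)" "n \<notin> C"
    using C by (auto simp: independent_insert spanC)
  have "card (insert n C) = dim (UNIV :: 'v set)"
    using ind(2) dimP C(4) finiteI_independent[OF C(2)] by simp
  then have "UNIV \<subseteq> span (insert n C)"
    using card_ge_dim_independent[of "insert n C" UNIV] ind(1) by auto
  then have sp: "v \<in> span (insert n C)" for v by blast
  define \<eta> where "\<eta> v = representation (insert n C) v n" for v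
  have add: "\<eta> (u + v) = \<eta> u + \<eta> v" for u v by (simp add: \<eta>_def representation_add ind sp)
  have scale: "\<eta> (sc c v) = c * \<eta> v" for c v by (simp add: \<eta>_def representation_scale ind sp)
  have en: "\<eta> n = 1" by (simp add: \<eta>_def representation_basis ind)
  have zero: "\<eta> v = 0" if "v \<in> P" for v
  proof -
    have "representation (insert n C) v = representation C v"
      using that spanC ind(1) by (intro representation_extend) auto
    then show ?thesis using representation_ne_zero[of C v n] ind(2) by (auto simp: \<eta>_def)
  qed
  have "v \<in> P" if "\<eta> v = 0" for v
  proof -
    obtain k where k: "v - sc k n \<in> P" using sp[of v] by (auto simp: span_insert spanC)
    then have "\<eta> (v - sc k n) = 0" by (rule zero)
    moreover have "\<eta> v = \<eta> (v - sc k n) + \<eta> (sc k n)" using add[of "v - sc k n" "sc k n"] by simp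
    ultimately have "k = 0" using that by (simp add: scale en)
    with k show ?thesis by simp
  qed
  with zero have "P = {v. \<eta> v = 0}" by blast
  moreover have "\<exists>v. \<eta> v \<noteq> 0" using en by (intro exI[of _ n]) simp
  ultimately show ?thesis using that add scale by blast
qed

text \<open>Normalizing the largest homogeneous coordinate to \<open>1\<close> bounds the others, so finitely many compact
  pieces of charts cover the space of hyperplanes.\<close>

lemma hyperplane_in_bounded_chart:
  assumes "P \<in> hyperplanes sc"
  shows "\<exists>i w. norm w \<le> real CARD('d) \<and> P = chart_hyperplane sc (b \<circ> Transposition.transpose None i) (w :: complex^'d)"
proof -
  obtain \<eta> :: "'v \<Rightarrow> complex" where \<eta>: "\<And>u v. \<eta> (u + v) = \<eta> u + \<eta> v" "\<And>c v. \<eta> (sc c v) = c * \<eta> v"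
    and P: "P = {v. \<eta> v = 0}" and nz: "\<exists>v. \<eta> v \<noteq> 0"
    using hyperplane_functional[OF assms] by blast
  have "Max (range (\<lambda>k. cmod (\<eta> (b k)))) \<in> range (\<lambda>k. cmod (\<eta> (b k)))" by (rule Max_in) auto
  then obtain i where "Max (range (\<lambda>k. cmod (\<eta> (b k)))) = cmod (\<eta> (b i))" by (rule rangeE)
  then have i: "cmod (\<eta> (b k)) \<le> cmod (\<eta> (b i))" for k
    using Max_ge[of "range (\<lambda>k. cmod (\<eta> (b k)))"] by (metis finite finite_imageI rangeI)
  have "\<eta> (b i) \<noteq> 0"
  proof
    assume "\<eta> (b i) = 0"
    then have "\<eta> (b k) = 0" for k using i[of k] by simp
    then have "\<eta> v = 0" for v using functional_expand[of \<eta> v, OF \<eta>] by simp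
    with nz show False by blast
  qed
  interpret swapped: basis_chart sc "b \<circ> Transposition.transpose None i"
    by unfold_locales (rule basis_swap)
  define w :: "complex^'d" where "w = (\<chi> j. \<eta> ((b \<circ> Transposition.transpose None i) (Some j)) / \<eta> (b i))"
  have "(\<lambda>v. \<eta> v / \<eta> (b i)) = chart_functional sc (b \<circ> Transposition.transpose None i) w"
    unfolding w_def using \<open>\<eta> (b i) \<noteq> 0\<close>
    by (intro swapped.chart_functional_eq) (simp_all add: \<eta> add_divide_distrib)
  then have "chart_functional sc (b \<circ> Transposition.transpose None i) w v = \<eta> v / \<eta> (b i)" for v by metis
  then have "P = chart_hyperplane sc (b \<circ> Transposition.transpose None i) w"
    using P \<open>\<eta> (b i) \<noteq> 0\<close> by (auto simp: chart_hyperplane_def)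
  moreover have "norm w \<le> (\<Sum>j\<in>UNIV. cmod (w $ j))"
    unfolding norm_vec_def by (rule L2_set_le_sum) simp
  moreover have "cmod (w $ j) \<le> 1" for j
    using i \<open>\<eta> (b i) \<noteq> 0\<close> by (simp add: w_def norm_divide divide_le_eq)
  then have "(\<Sum>j\<in>UNIV. cmod (w $ j)) \<le> real CARD('d)"
    using sum_bounded_above[of UNIV "\<lambda>j. cmod (w $ j)" 1] by simp
  ultimately show ?thesis by (intro exI[of _ i] exI[of _ w]) auto
qed

lemma chart_weight:
  assumes "positively_curved (O1_PV sc :: ('v set, 'v set, 'd, unit) hol_bundle) h"
  shows "h (chart_hyperplane sc b w, chart_coset sc b w t) =
      (cmod (t $ ()))\<^sup>2 * h (chart_hyperplane sc b w, chart_coset sc b w 1)"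
    and "h (chart_hyperplane sc b w, chart_coset sc b w 1) > 0"
    and "smooth_on UNIV (\<lambda>w. - ln (h (chart_hyperplane sc b w, chart_coset sc b w 1)))"
    and "strongly_psh_at (\<lambda>w. - ln (h (chart_hyperplane sc b w, chart_coset sc b w 1))) w"
proof -
  let ?E = "O1_PV sc :: ('v set, 'v set, 'd, unit) hol_bundle"
  have base: "chart_hyperplane sc b w \<in> base ?E" for w
    using chart_hyperplane_in_hyperplanes by (simp add: O1_PV_def)
  have met: "is_metric ?E h" using assms by (simp add: positively_curved_def)
  show "h (chart_hyperplane sc b w, chart_coset sc b w t) =
      (cmod (t $ ()))\<^sup>2 * h (chart_hyperplane sc b w, chart_coset sc b w 1)"
    "h (chart_hyperplane sc b w, chart_coset sc b w 1) > 0"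
    using is_metric_line[OF line_triv_O1_PV met base] by blast+
  have "(UNIV, chart_hyperplane sc b, chart_coset sc b) \<in> trivs ?E"
    using is_basis by (auto simp: O1_PV_def)
  from positively_curved_lineD[OF assms this base line_triv_O1_PV]
  show "smooth_on UNIV (\<lambda>w. - ln (h (chart_hyperplane sc b w, chart_coset sc b w 1)))"
    "strongly_psh_at (\<lambda>w. - ln (h (chart_hyperplane sc b w, chart_coset sc b w 1))) w"
    by blast+
qed

lemma ln_ratio_bounds_chart:
  assumes pc: "positively_curved (O1_PV sc :: ('v set, 'v set, 'd, unit) hol_bundle) g"
      "positively_curved (O1_PV sc :: ('v set, 'v set, 'd, unit) hol_bundle) h"
    and less: "\<And>P q. P \<in> hyperplanes sc \<Longrightarrow> q \<in> quot P \<Longrightarrow> q \<noteq> P \<Longrightarrow> h (P, q) < g (P, q)"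
  shows "\<exists>\<delta>>0. \<exists>M. \<forall>w. norm w \<le> R \<longrightarrow> (\<forall>q\<in>quot (chart_hyperplane sc b w). q \<noteq> chart_hyperplane sc b w \<longrightarrow>
    \<delta> \<le> ln (g (chart_hyperplane sc b w, q)) - ln (h (chart_hyperplane sc b w, q)) \<and>
    ln (g (chart_hyperplane sc b w, q)) - ln (h (chart_hyperplane sc b w, q)) \<le> M)"
proof -
  let ?P = "chart_hyperplane sc b" and ?\<tau> = "chart_coset sc b"
  define D where "D w = ln (g (?P w, ?\<tau> w 1)) - ln (h (?P w, ?\<tau> w 1))" for w
  note G = chart_weight[OF pc(1)] and H = chart_weight[OF pc(2)]
  have "smooth_on UNIV (\<lambda>w. - ln (h (?P w, ?\<tau> w 1)) - (- ln (g (?P w, ?\<tau> w 1))))"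
    by (intro smooth_on_diff open_UNIV G(3) H(3))
  then have "smooth_on UNIV D" by (simp add: D_def[abs_def])
  then have cont: "continuous_on (cball 0 R) D"
    by (meson continuous_at_imp_continuous_on smooth_on_imp_isCont)
  have one: "(1 :: complex^unit) \<noteq> 0" by (simp add: vec_eq_iff)
  have inj: "inj (?\<tau> w)" and ran: "range (?\<tau> w) = quot (?P w)" for w
    using chart_coset_bij by (auto simp: bij_betw_def)
  have pos: "D w > 0" for w
  proof -
    have "?\<tau> w 1 \<noteq> ?P w" using one injD[OF inj] by (metis chart_coset_0)
    moreover have "?\<tau> w 1 \<in> quot (?P w)" using ran by blast
    ultimately have "h (?P w, ?\<tau> w 1) < g (?P w, ?\<tau> w 1)"
      using less chart_hyperplane_in_hyperplanes by blast
    then show ?thesis using H(2)[of w] by (simp add: D_def)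
  qed
  have eq: "\<exists>t. t \<noteq> 0 \<and> q = ?\<tau> w t" "ln (g (?P w, q)) - ln (h (?P w, q)) = D w"
    if "q \<in> quot (?P w)" "q \<noteq> ?P w" for q w
  proof -
    obtain t where t: "q = ?\<tau> w t" using \<open>q \<in> quot (?P w)\<close> ran by blast
    with that have "t \<noteq> 0" using chart_coset_0 by metis
    then show "\<exists>t. t \<noteq> 0 \<and> q = ?\<tau> w t" using t by blast
    have "t $ () \<noteq> 0" using \<open>t \<noteq> 0\<close> by (simp add: complex_vec_unit_eq_0)
    then show "ln (g (?P w, q)) - ln (h (?P w, q)) = D w"
      unfolding t G(1)[of w t] H(1)[of w t] using G(2)[of w] H(2)[of w]
      by (simp add: D_def ln_mult)
  qed
  show ?thesis
  proof (cases "cball (0 :: complex^'d) R = {}")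
    case True
    then have "\<not> norm (w :: complex^'d) \<le> R" for w by (metis empty_iff mem_cball_0)
    then show ?thesis using zero_less_one by blast
  next
    case False
    obtain w0 where "\<forall>w\<in>cball 0 R. D w0 \<le> D w"
      using continuous_attains_inf[OF compact_cball False cont] by blast
    then have w0: "D w0 \<le> D w" if "norm w \<le> R" for w using that by simp
    obtain w1 where "\<forall>w\<in>cball 0 R. D w \<le> D w1"
      using continuous_attains_sup[OF compact_cball False cont] by blast
    then have w1: "D w \<le> D w1" if "norm w \<le> R" for w using that by simp
    show ?thesis
      using pos[of w0] w0 w1 by (intro exI[of _ "D w0"] conjI exI[of _ "D w1"]) (auto simp: eq(2))
  qed
qed

lemma ln_ratio_bounds:
  assumes pc: "positively_curved (O1_PV sc :: ('v set, 'v set, 'd, unit) hol_bundle) g"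
      "positively_curved (O1_PV sc :: ('v set, 'v set, 'd, unit) hol_bundle) h"
    and less: "\<And>P q. P \<in> hyperplanes sc \<Longrightarrow> q \<in> quot P \<Longrightarrow> q \<noteq> P \<Longrightarrow> h (P, q) < g (P, q)"
  shows "\<exists>\<delta>>0. \<exists>M. \<forall>P\<in>hyperplanes sc. \<forall>q\<in>quot P. q \<noteq> P \<longrightarrow>
    \<delta> \<le> ln (g (P, q)) - ln (h (P, q)) \<and> ln (g (P, q)) - ln (h (P, q)) \<le> M"
proof -
  let ?P = "\<lambda>i. chart_hyperplane sc (b \<circ> Transposition.transpose None i) :: complex^'d \<Rightarrow> 'v set"
  have "\<exists>\<delta>>0. \<exists>M. \<forall>w. norm w \<le> real CARD('d) \<longrightarrow> (\<forall>q\<in>quot (?P i w). q \<noteq> ?P i w \<longrightarrow>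
    \<delta> \<le> ln (g (?P i w, q)) - ln (h (?P i w, q)) \<and> ln (g (?P i w, q)) - ln (h (?P i w, q)) \<le> M)" for i
  proof -
    interpret swapped: basis_chart sc "b \<circ> Transposition.transpose None i"
      by unfold_locales (rule basis_swap)
    show ?thesis by (rule swapped.ln_ratio_bounds_chart[OF pc less])
  qed
  then obtain d M where d: "\<And>i. d i > 0"
    and bounds: "\<And>i w q. norm w \<le> real CARD('d) \<Longrightarrow>
      q \<in> quot (?P i w) \<Longrightarrow> q \<noteq> ?P i w \<Longrightarrow>
      d i \<le> ln (g (?P i w, q)) - ln (h (?P i w, q)) \<and> ln (g (?P i w, q)) - ln (h (?P i w, q)) \<le> M i"
    by metis
  have "Min (range d) > 0" using d by (subst Min_gr_iff) auto
  moreover have "Min (range d) \<le> ln (g (P, q)) - ln (h (P, q)) \<and>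
      ln (g (P, q)) - ln (h (P, q)) \<le> Max (range M)"
    if "P \<in> hyperplanes sc" and q: "q \<in> quot P" "q \<noteq> P" for P q
  proof -
    obtain i w where w: "norm w \<le> real CARD('d)" "P = ?P i w"
      using hyperplane_in_bounded_chart[OF \<open>P \<in> hyperplanes sc\<close>] by blast
    have "Min (range d) \<le> d i" "M i \<le> Max (range M)" by simp_all
    then show ?thesis using bounds[OF w(1), of q i] q unfolding w(2) by linarith
  qed
  ultimately show ?thesis by blast
qed

end

lemma (in vector_space) exists_basis:
  assumes "dim (UNIV :: 'b set) = CARD('d::finite) + 1"
  shows "\<exists>b :: 'd option \<Rightarrow> 'b. inj b \<and> independent (range b) \<and> span (range b) = UNIV"
proof -
  obtain C :: "'b set" where C: "independent C" "UNIV \<subseteq> span C" "card C = CARD('d) + 1"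
    using basis_exists[of UNIV] assms by metis
  then have "finite C" by (metis card.infinite add_is_0 one_neq_zero)
  have "card (UNIV :: 'd option set) = card C" using C(3) by simp
  then obtain b :: "'d option \<Rightarrow> 'b" where "bij_betw b UNIV C"
    using finite_same_card_bij[OF finite \<open>finite C\<close>] by blast
  then show ?thesis using C by (intro exI[of _ b]) (auto simp: bij_betw_def)
qed

section \<open>Gluing the three metrics\<close>

definition reg_max :: "(real \<Rightarrow> real) \<Rightarrow> real \<Rightarrow> real \<Rightarrow> real" where
  "reg_max \<theta> f g = g + \<theta> (f - g)"

lemma reg_max_shift: "reg_max \<theta> (f - c) (g - c) = reg_max \<theta> f g - c"
  by (simp add: reg_max_def)

definition glued_weight ::
    "(real \<Rightarrow> real) \<Rightarrow> (nat \<Rightarrow> real) \<Rightarrow> (nat \<Rightarrow> real) \<Rightarrow> (nat \<Rightarrow> real) \<Rightarrow> real \<Rightarrow> real" where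
  "glued_weight \<theta> A \<sigma> \<phi> x =
     reg_max \<theta> (reg_max \<theta> (\<phi> 1 + A 1 * (x - \<sigma> 1)) (\<phi> 2 + A 2 * (x - \<sigma> 2))) (\<phi> 3 + A 3 * (x - \<sigma> 3))"

definition glued_metric ::
    "(real \<Rightarrow> real) \<Rightarrow> (nat \<Rightarrow> real) \<Rightarrow> (nat \<Rightarrow> real) \<Rightarrow> (nat \<Rightarrow> 'v set \<times> 'v set \<Rightarrow> real) \<Rightarrow>
      ('s::real_normed_vector \<times> 'v set) \<times> 'v set \<Rightarrow> real" where
  "glued_metric \<theta> A \<sigma> \<kappa> = (\<lambda>((s, P), q).
     if q = P then 0 else exp (- glued_weight \<theta> A \<sigma> (\<lambda>j. - ln (\<kappa> j (P, q))) ((norm s)\<^sup>2)))"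

lemma glued_weight_shift:
  "glued_weight \<theta> A \<sigma> (\<lambda>j. \<phi> j - c) x = glued_weight \<theta> A \<sigma> \<phi> x - c"
proof -
  have *: "\<phi> j - c + y = (\<phi> j + y) - c" for j y by simp
  show ?thesis unfolding glued_weight_def * reg_max_shift ..
qed

lemma glued_weight_cong:
  "(\<And>j. j \<in> {1, 2, 3} \<Longrightarrow> \<phi> j = \<psi> j) \<Longrightarrow> glued_weight \<theta> A \<sigma> \<phi> x = glued_weight \<theta> A \<sigma> \<psi> x"
  by (simp add: glued_weight_def)

lemma glued_weight_strongly_psh:
  fixes \<phi> :: "nat \<Rightarrow> complex^'d::finite \<Rightarrow> real" and \<theta> \<theta>1 \<theta>2 :: "real \<Rightarrow> real"
    and A \<sigma> :: "nat \<Rightarrow> real"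
  defines "\<Phi> \<equiv> \<lambda>z :: complex^('m::finite + 'd).
    glued_weight \<theta> A \<sigma> (\<lambda>j. \<phi> j (coords2 z)) ((norm (coords1 z))\<^sup>2)"
  assumes \<theta>: "smooth_on UNIV \<theta>" "\<And>x. (\<theta> has_real_derivative \<theta>1 x) (at x)"
      "\<And>x. (\<theta>1 has_real_derivative \<theta>2 x) (at x)" "\<And>x. 0 \<le> \<theta>1 x \<and> \<theta>1 x \<le> 1 \<and> 0 \<le> \<theta>2 x"
    and A: "\<And>j. j \<in> {1, 2, 3} \<Longrightarrow> A j > 0"
    and \<phi>: "\<And>j. j \<in> {1, 2, 3} \<Longrightarrow> smooth_on UNIV (\<phi> j)"
      "\<And>j w. j \<in> {1, 2, 3} \<Longrightarrow> strongly_psh_at (\<phi> j) w"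
  shows "smooth_on UNIV \<Phi>" "strongly_psh_at \<Phi> z"
proof -
  let ?f = "\<lambda>j (z :: complex^('m + 'd)). \<phi> j (coords2 z) + A j * ((norm (coords1 z))\<^sup>2 - \<sigma> j)"
  have f: "smooth_on UNIV (?f j)" "\<And>z. strongly_psh_at (?f j) z" if "j \<in> {1, 2, 3}" for j
    using add_norm_square_strongly_psh[OF A[OF that] \<phi>[OF that]] by blast+
  note f1 = f[of 1, simplified] and f2 = f[of 2, simplified] and f3 = f[of 3, simplified]
  note g = regularized_max_strongly_psh[OF f1(1) f2(1) \<theta> f1(2) f2(2)]
  note h = regularized_max_strongly_psh[OF g(1) f3(1) \<theta> g(2) f3(2)]
  show "smooth_on UNIV \<Phi>" "strongly_psh_at \<Phi> z"
    unfolding \<Phi>_def glued_weight_def reg_max_def using h by simp_all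
qed

text \<open>The slope \<open>A\<^sub>2\<close> makes the second weight fall below the first on the way down from \<open>\<sigma>\<^sub>2\<close> to \<open>\<sigma>\<^sub>1\<close>;
  then \<open>\<sigma>\<^sub>3\<close> is chosen so close to \<open>\<sigma>\<^sub>2\<close> that this slope cannot yet bridge the gap \<open>\<delta>\<close>, and \<open>A\<^sub>3\<close> is
  large relative to \<open>\<sigma>\<^sub>3 - \<sigma>\<^sub>2\<close>.\<close>

lemma exists_gluing_constants:
  fixes \<delta> M :: real
  assumes "\<delta> > 0"
  shows "\<exists>(A :: nat \<Rightarrow> real) \<sigma> \<nu>. \<nu> > 0 \<and> (\<forall>j\<in>{1, 2, 3}. A j > 0) \<and>
    0 < \<sigma> 1 \<and> \<sigma> 1 < \<sigma> 2 \<and> \<sigma> 2 < \<sigma> 3 \<and> \<sigma> 3 < 1 \<and>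
    (\<forall>\<phi> x. \<delta> \<le> \<phi> 2 - \<phi> 1 \<and> \<phi> 2 - \<phi> 1 \<le> M \<and> \<delta> \<le> \<phi> 3 - \<phi> 2 \<and> \<phi> 3 - \<phi> 2 \<le> M \<longrightarrow>
      (let \<psi> = (\<lambda>j :: nat. \<phi> j + A j * (x - \<sigma> j)) in
       (\<bar>x - \<sigma> 1\<bar> < \<nu> \<longrightarrow> \<psi> 1 - \<psi> 2 \<ge> \<delta> / 4 \<and> \<psi> 2 - \<psi> 3 \<ge> \<delta> / 4) \<and>
       (\<bar>x - \<sigma> 2\<bar> < \<nu> \<longrightarrow> \<psi> 2 - \<psi> 1 \<ge> \<delta> / 4 \<and> \<psi> 2 - \<psi> 3 \<ge> \<delta> / 4) \<and>
       (\<bar>x - \<sigma> 3\<bar> < \<nu> \<longrightarrow> \<psi> 2 - \<psi> 1 \<ge> \<delta> / 4 \<and> \<psi> 3 - \<psi> 2 \<ge> \<delta> / 4)))"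
proof -
  define N where "N = max M \<delta>"
  define a2 where "a2 = 4 * N + 8 * \<delta>"
  define \<eta> where "\<eta> = \<delta> / (2 * a2)"
  define a3 where "a3 = (N + \<delta> + a2) / \<eta>"
  define \<nu> where "\<nu> = \<delta> / (8 * a3)"
  have N: "N \<ge> \<delta>" "M \<le> N" by (auto simp: N_def)
  have a2: "a2 \<ge> 12 * \<delta>" using N by (simp add: a2_def)
  then have a2p: "a2 > 0" using assms by linarith
  then have \<eta>: "\<eta> > 0" using assms by (simp add: \<eta>_def)
  have a2\<eta>: "a2 * \<eta> = \<delta> / 2" using a2p by (simp add: \<eta>_def)
  have \<eta>le: "\<eta> \<le> 1 / 16" using a2 a2p assms by (simp add: \<eta>_def field_simps)
  have a3\<eta>: "a3 * \<eta> = N + \<delta> + a2" using \<eta> by (simp add: a3_def)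
  have a3p: "a3 > 0" using \<eta> N assms a2p by (auto simp: a3_def intro!: divide_pos_pos)
  have "a3 * \<eta> \<le> a3 * 1" using \<eta>le a3p by (intro mult_left_mono) auto
  then have a3: "a3 \<ge> a2" using a3\<eta> N assms by linarith
  have \<nu>: "\<nu> > 0" "a3 * \<nu> = \<delta> / 8" using a3p assms by (auto simp: \<nu>_def)
  have d\<eta>: "\<delta> * \<eta> \<le> \<delta> / 16" using mult_left_mono[OF \<eta>le, of \<delta>] assms by simp
  have small: "\<bar>(a2 - \<delta>) * y\<bar> \<le> \<delta> / 8 \<and> \<bar>(a3 - a2) * y\<bar> \<le> \<delta> / 8" if "\<bar>y\<bar> < \<nu>" for y
  proof -
    have "\<bar>c * y\<bar> \<le> a3 * \<nu>" if "0 \<le> c" "c \<le> a3" for c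
      unfolding abs_mult using that \<open>\<bar>y\<bar> < \<nu>\<close> a3p by (intro mult_mono) auto
    then show ?thesis using \<nu>(2) a2 a3 a2p assms by auto
  qed
  define A where "A = (\<lambda>j :: nat. if j = 1 then \<delta> else if j = 2 then a2 else a3)"
  define \<sigma> where "\<sigma> = (\<lambda>j :: nat. if j = 1 then 1 / 4 else if j = 2 then 1 / 2 else 1 / 2 + \<eta>)"
  note lin = N a2 a2\<eta> a3\<eta> d\<eta> a3 assms a2_def
  have *: "\<phi> 1 + A 1 * (x - \<sigma> 1) - (\<phi> 2 + A 2 * (x - \<sigma> 2)) =
      (\<phi> 1 - \<phi> 2) - ((a2 - \<delta>) * (x - 1 / 4)) + a2 / 4"
     "\<phi> 1 + A 1 * (x - \<sigma> 1) - (\<phi> 2 + A 2 * (x - \<sigma> 2)) =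
      (\<phi> 1 - \<phi> 2) - ((a2 - \<delta>) * (x - 1 / 2)) + \<delta> / 4"
     "\<phi> 1 + A 1 * (x - \<sigma> 1) - (\<phi> 2 + A 2 * (x - \<sigma> 2)) =
      (\<phi> 1 - \<phi> 2) - ((a2 - \<delta>) * (x - (1 / 2 + \<eta>))) + \<delta> / 4 + \<delta> * \<eta> - a2 * \<eta>"
     "\<phi> 2 + A 2 * (x - \<sigma> 2) - (\<phi> 3 + A 3 * (x - \<sigma> 3)) =
      (\<phi> 2 - \<phi> 3) - ((a3 - a2) * (x - 1 / 4)) + a3 / 4 - a2 / 4 + a3 * \<eta>"
     "\<phi> 2 + A 2 * (x - \<sigma> 2) - (\<phi> 3 + A 3 * (x - \<sigma> 3)) =
      (\<phi> 2 - \<phi> 3) - ((a3 - a2) * (x - 1 / 2)) + a3 * \<eta>"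
     "\<phi> 2 + A 2 * (x - \<sigma> 2) - (\<phi> 3 + A 3 * (x - \<sigma> 3)) =
      (\<phi> 2 - \<phi> 3) - ((a3 - a2) * (x - (1 / 2 + \<eta>))) + a2 * \<eta>" for \<phi> :: "nat \<Rightarrow> real" and x
    by (simp_all add: A_def \<sigma>_def field_simps)
  show ?thesis
  proof (intro exI conjI allI impI)
    show "\<nu> > 0" by (rule \<nu>)
    show "\<forall>j\<in>{1, 2, 3}. A j > 0" using a2p a3p assms by (simp add: A_def)
    show "0 < \<sigma> 1" "\<sigma> 1 < \<sigma> 2" "\<sigma> 2 < \<sigma> 3" "\<sigma> 3 < 1" using \<eta> \<eta>le by (simp_all add: \<sigma>_def)
    fix \<phi> :: "nat \<Rightarrow> real" and x
    assume D: "\<delta> \<le> \<phi> 2 - \<phi> 1 \<and> \<phi> 2 - \<phi> 1 \<le> M \<and> \<delta> \<le> \<phi> 3 - \<phi> 2 \<and> \<phi> 3 - \<phi> 2 \<le> M"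
    show "let \<psi> = (\<lambda>j :: nat. \<phi> j + A j * (x - \<sigma> j)) in
       (\<bar>x - \<sigma> 1\<bar> < \<nu> \<longrightarrow> \<psi> 1 - \<psi> 2 \<ge> \<delta> / 4 \<and> \<psi> 2 - \<psi> 3 \<ge> \<delta> / 4) \<and>
       (\<bar>x - \<sigma> 2\<bar> < \<nu> \<longrightarrow> \<psi> 2 - \<psi> 1 \<ge> \<delta> / 4 \<and> \<psi> 2 - \<psi> 3 \<ge> \<delta> / 4) \<and>
       (\<bar>x - \<sigma> 3\<bar> < \<nu> \<longrightarrow> \<psi> 2 - \<psi> 1 \<ge> \<delta> / 4 \<and> \<psi> 3 - \<psi> 2 \<ge> \<delta> / 4)"
      unfolding Let_def
    proof (intro conjI impI)
      assume "\<bar>x - \<sigma> 1\<bar> < \<nu>"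
      then have "\<bar>x - 1 / 4\<bar> < \<nu>" by (simp add: \<sigma>_def)
      note s = small[OF this]
      show "\<phi> 1 + A 1 * (x - \<sigma> 1) - (\<phi> 2 + A 2 * (x - \<sigma> 2)) \<ge> \<delta> / 4"
        unfolding *(1) using s D lin by linarith
      show "\<phi> 2 + A 2 * (x - \<sigma> 2) - (\<phi> 3 + A 3 * (x - \<sigma> 3)) \<ge> \<delta> / 4"
        unfolding *(4) using s D lin by linarith
    next
      assume "\<bar>x - \<sigma> 2\<bar> < \<nu>"
      then have "\<bar>x - 1 / 2\<bar> < \<nu>" by (simp add: \<sigma>_def)
      note s = small[OF this]
      show "\<phi> 2 + A 2 * (x - \<sigma> 2) - (\<phi> 1 + A 1 * (x - \<sigma> 1)) \<ge> \<delta> / 4"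
        using *(2)[of \<phi> x] s D lin by linarith
      show "\<phi> 2 + A 2 * (x - \<sigma> 2) - (\<phi> 3 + A 3 * (x - \<sigma> 3)) \<ge> \<delta> / 4"
        unfolding *(5) using s D lin by linarith
    next
      assume "\<bar>x - \<sigma> 3\<bar> < \<nu>"
      then have "\<bar>x - (1 / 2 + \<eta>)\<bar> < \<nu>" by (simp add: \<sigma>_def)
      note s = small[OF this]
      show "\<phi> 2 + A 2 * (x - \<sigma> 2) - (\<phi> 1 + A 1 * (x - \<sigma> 1)) \<ge> \<delta> / 4"
        using *(3)[of \<phi> x] s D lin by linarith
      show "\<phi> 3 + A 3 * (x - \<sigma> 3) - (\<phi> 2 + A 2 * (x - \<sigma> 2)) \<ge> \<delta> / 4"
        using *(6)[of \<phi> x] s D lin by linarith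
    qed
  qed
qed

context basis_chart
begin

lemma glued_metric_chart:
  assumes "\<And>j. j \<in> {1, 2, 3} \<Longrightarrow>
    positively_curved (O1_PV sc :: ('v set, 'v set, 'd, unit) hol_bundle) (\<kappa> j)"
  shows "glued_metric \<theta> A \<sigma> \<kappa> ((s, chart_hyperplane sc b w), chart_coset sc b w t) = (cmod (t $ ()))\<^sup>2 *
    exp (- glued_weight \<theta> A \<sigma>
      (\<lambda>j. - ln (\<kappa> j (chart_hyperplane sc b w, chart_coset sc b w 1))) ((norm s)\<^sup>2))"
proof (cases "t = 0")
  case True
  then show ?thesis by (simp add: glued_metric_def chart_coset_0)
next
  case False
  let ?P = "chart_hyperplane sc b w" and ?\<tau> = "chart_coset sc b w"
  have ne: "?\<tau> t \<noteq> ?P"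
    using False chart_coset_bij by (metis bij_betw_def chart_coset_0 injD)
  have t: "cmod (t $ ()) > 0" using False by (simp add: complex_vec_unit_eq_0)
  have "- ln (\<kappa> j (?P, ?\<tau> t)) = - ln (\<kappa> j (?P, ?\<tau> 1)) - ln ((cmod (t $ ()))\<^sup>2)" if "j \<in> {1, 2, 3}" for j
    unfolding chart_weight(1)[OF assms[OF that], of w t] using chart_weight(2)[OF assms[OF that], of w] t
    by (simp add: ln_mult)
  then have "glued_weight \<theta> A \<sigma> (\<lambda>j. - ln (\<kappa> j (?P, ?\<tau> t))) ((norm s)\<^sup>2) =
      glued_weight \<theta> A \<sigma> (\<lambda>j. - ln (\<kappa> j (?P, ?\<tau> 1)) - ln ((cmod (t $ ()))\<^sup>2)) ((norm s)\<^sup>2)"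
    by (rule glued_weight_cong)
  also have "\<dots> = glued_weight \<theta> A \<sigma> (\<lambda>j. - ln (\<kappa> j (?P, ?\<tau> 1))) ((norm s)\<^sup>2) - ln ((cmod (t $ ()))\<^sup>2)"
    by (rule glued_weight_shift)
  finally have weight: "glued_weight \<theta> A \<sigma> (\<lambda>j. - ln (\<kappa> j (?P, ?\<tau> t))) ((norm s)\<^sup>2) = \<dots>" .
  have exp: "exp (- (y - ln T)) = T * exp (- y)" if "T > 0" for y T :: real
    using that by (simp add: exp_diff exp_minus divide_inverse)
  have "exp (- glued_weight \<theta> A \<sigma> (\<lambda>j. - ln (\<kappa> j (?P, ?\<tau> t))) ((norm s)\<^sup>2)) =
      (cmod (t $ ()))\<^sup>2 * exp (- glued_weight \<theta> A \<sigma> (\<lambda>j. - ln (\<kappa> j (?P, ?\<tau> 1))) ((norm s)\<^sup>2))"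
    unfolding weight by (rule exp) (use t in simp)
  then show ?thesis using ne by (simp add: glued_metric_def)
qed

lemma hyperplane_chart:
  assumes "P \<in> hyperplanes sc"
  obtains b' :: "'d option \<Rightarrow> 'v" and w where "is_basis sc b'" "P = chart_hyperplane sc b' w"
  using hyperplane_in_bounded_chart[OF assms] basis_swap by blast

lemma positively_curved_glued_metric:
  assumes pc: "\<And>j. j \<in> {1, 2, 3} \<Longrightarrow>
      positively_curved (O1_PV sc :: ('v set, 'v set, 'd, unit) hol_bundle) (\<kappa> j)"
    and \<theta>: "smooth_on UNIV \<theta>" "\<And>x. (\<theta> has_real_derivative \<theta>1 x) (at x)"
      "\<And>x. (\<theta>1 has_real_derivative \<theta>2 x) (at x)" "\<And>x. 0 \<le> \<theta>1 x \<and> \<theta>1 x \<le> 1 \<and> 0 \<le> \<theta>2 x"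
    and A: "\<And>j. j \<in> {1, 2, 3} \<Longrightarrow> A j > 0" and B: "open B"
  shows "positively_curved (O1_PF B sc :: ((complex^'m::finite) \<times> 'v set, 'v set, 'm + 'd, unit) hol_bundle)
    (glued_metric \<theta> A \<sigma> \<kappa>)"
proof (rule positively_curved_lineI)
  let ?F = "O1_PF B sc :: ((complex^'m) \<times> 'v set, 'v set, 'm + 'd, unit) hol_bundle"
  let ?V = "O1_PV sc :: ('v set, 'v set, 'd, unit) hol_bundle"
  let ?k = "glued_metric \<theta> A \<sigma> \<kappa> :: ((complex^'m) \<times> 'v set) \<times> 'v set \<Rightarrow> real"
  have triv: "\<exists>\<tau>. line_triv ?F (s, P) \<tau> \<and> line_triv ?V P \<tau> \<and> (\<exists>c>0. \<forall>q\<in>quot P. ?k ((s, P), q) = c * \<kappa> 1 (P, q))"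
    if P: "P \<in> hyperplanes sc" for s :: "complex^'m" and P
  proof -
    obtain b' :: "'d option \<Rightarrow> 'v" and w where b': "is_basis sc b'" "P = chart_hyperplane sc b' w"
      using hyperplane_chart[OF P] .
    interpret C: basis_chart sc b' by unfold_locales (rule b'(1))
    let ?E = "\<lambda>t. exp (- glued_weight \<theta> A \<sigma> (\<lambda>j. - ln (\<kappa> j (P, chart_coset sc b' w 1))) ((norm s)\<^sup>2))"
    have pos: "\<kappa> 1 (P, chart_coset sc b' w 1) > 0"
      unfolding b'(2) using C.chart_weight(2)[OF pc] by simp
    have "?k ((s, P), q) = ?E 0 / \<kappa> 1 (P, chart_coset sc b' w 1) * \<kappa> 1 (P, q)" if "q \<in> quot P" for q
    proof -
      obtain t where t: "q = chart_coset sc b' w t"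
        using \<open>q \<in> quot P\<close> C.chart_coset_bij[of w] by (auto simp: b'(2) bij_betw_def)
      have "\<kappa> 1 (P, q) = (cmod (t $ ()))\<^sup>2 * \<kappa> 1 (P, chart_coset sc b' w 1)"
        unfolding b'(2) t by (rule C.chart_weight(1)[OF pc]) simp
      then show ?thesis
        using C.glued_metric_chart[where \<theta> = \<theta> and A = A and \<sigma> = \<sigma> and s = s and w = w and t = t, OF pc] pos
        by (simp add: t b'(2)[symmetric])
    qed
    moreover have "?E 0 / \<kappa> 1 (P, chart_coset sc b' w 1) > 0" using pos by simp
    ultimately show ?thesis
      using C.line_triv_O1_PF[of B s w] C.line_triv_O1_PV[of w] unfolding b'(2)[symmetric] by blast
  qed
  show "\<exists>\<tau>. line_triv ?F p \<tau>" if "p \<in> base ?F" for p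
  proof -
    obtain s P where "p = (s, P)" "P \<in> hyperplanes sc"
      using \<open>p \<in> base ?F\<close> by (auto simp: O1_PF_def)
    then show ?thesis using triv by blast
  qed
  show "is_metric ?F ?k"
    unfolding is_metric_def
  proof
    fix p assume "p \<in> base ?F"
    then obtain s P where p: "p = (s, P)" "P \<in> hyperplanes sc" by (auto simp: O1_PF_def)
    obtain c where c: "c > 0" "\<And>q. q \<in> quot P \<Longrightarrow> ?k ((s, P), q) = c * \<kappa> 1 (P, q)"
      using triv[OF p(2), of s] by blast
    have "is_metric ?V (\<kappa> 1)" using pc[of 1] by (simp add: positively_curved_def)
    moreover have "P \<in> base ?V" using p(2) by (simp add: O1_PV_def)
    ultimately obtain H where H: "hermitian_form_on ?V P H" "pos_def_on ?V P H"
      "\<forall>q\<in>fibre ?V P. complex_of_real (\<kappa> 1 (P, q)) = H q q"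
      unfolding is_metric_def by blast
    show "\<exists>H. hermitian_form_on ?F p H \<and> pos_def_on ?F p H \<and>
        (\<forall>q\<in>fibre ?F p. complex_of_real (?k (p, q)) = H q q)"
    proof (intro exI[of _ "\<lambda>x y. complex_of_real c * H x y"] conjI)
      show "hermitian_form_on ?F p (\<lambda>x y. complex_of_real c * H x y)"
        unfolding hermitian_form_on_def
      proof (intro conjI ballI allI)
        fix x y z a assume "x \<in> fibre ?F p" "y \<in> fibre ?F p"
        then have xy: "x \<in> fibre ?V P" "y \<in> fibre ?V P" by (simp_all add: p O1_PF_def O1_PV_def)
        have ops: "fadd ?F p = fadd ?V P" "fscale ?F p = fscale ?V P" "fibre ?F p = fibre ?V P"
          by (simp_all add: p O1_PF_def O1_PV_def)
        show "complex_of_real c * H (fadd ?F p x y) z = complex_of_real c * H x z + complex_of_real c * H y z"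
          if "z \<in> fibre ?F p"
        proof -
          have "H (fadd ?V P x y) z = H x z + H y z"
            using H(1) xy that unfolding hermitian_form_on_def ops by blast
          then show ?thesis by (simp add: ops distrib_left)
        qed
        have "H (fscale ?V P a x) y = a * H x y"
          using H(1) xy unfolding hermitian_form_on_def by blast
        then show "complex_of_real c * H (fscale ?F p a x) y = a * (complex_of_real c * H x y)"
          by (simp add: ops)
        have "H y x = cnj (H x y)" using H(1) xy unfolding hermitian_form_on_def by blast
        then show "complex_of_real c * H y x = cnj (complex_of_real c * H x y)" by simp
      qed
      show "pos_def_on ?F p (\<lambda>x y. complex_of_real c * H x y)"
        using H(2) c(1) by (auto simp: pos_def_on_def p O1_PF_def O1_PV_def)
      show "\<forall>q\<in>fibre ?F p. complex_of_real (?k (p, q)) = complex_of_real c * H q q"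
        using H(3) c(2) by (auto simp: p O1_PF_def O1_PV_def)
    qed
  qed
  fix U x \<tau> assume "(U, x, \<tau>) \<in> trivs ?F"
  then obtain b' :: "'d option \<Rightarrow> 'v" where b': "is_basis sc b'"
    and eq: "U = {z. coords1 z \<in> B}" "x = (\<lambda>z. (coords1 z, chart_hyperplane sc b' (coords2 z)))"
      "\<tau> = (\<lambda>z. chart_coset sc b' (coords2 z))"
    by (auto simp: O1_PF_def)
  interpret C: basis_chart sc b' by unfold_locales (rule b')
  let ?\<Phi> = "\<lambda>z :: complex^('m + 'd). glued_weight \<theta> A \<sigma>
    (\<lambda>j. - ln (\<kappa> j (chart_hyperplane sc b' (coords2 z), chart_coset sc b' (coords2 z) 1))) ((norm (coords1 z))\<^sup>2)"
  have \<Phi>: "smooth_on UNIV ?\<Phi>" "\<And>z. strongly_psh_at ?\<Phi> z"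
    using glued_weight_strongly_psh[where \<phi> = "\<lambda>j w. - ln (\<kappa> j (chart_hyperplane sc b' w, chart_coset sc b' w 1))"
        and A = A and \<sigma> = \<sigma>, OF \<theta> A C.chart_weight(3)[OF pc] C.chart_weight(4)[OF pc]] by blast+
  show "\<exists>\<Phi>. open U \<and> smooth_on U \<Phi> \<and> (\<forall>z\<in>U. strongly_psh_at \<Phi> z) \<and>
      (\<forall>z. line_triv ?F (x z) (\<tau> z) \<and> (\<forall>t. ?k (x z, \<tau> z t) = (cmod (t $ ()))\<^sup>2 * exp (- \<Phi> z)))"
  proof (intro exI[of _ ?\<Phi>] conjI allI ballI)
    show "open U" unfolding eq by (rule open_coords1_vimage[OF B])
    show "smooth_on U ?\<Phi>" using \<Phi>(1) by (rule smooth_on_subset) simp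
    show "strongly_psh_at ?\<Phi> z" for z by (rule \<Phi>(2))
    show "line_triv ?F (x z) (\<tau> z)" for z unfolding eq by (rule C.line_triv_O1_PF)
    show "?k (x z, \<tau> z t) = (cmod (t $ ()))\<^sup>2 * exp (- ?\<Phi> z)" for z t
      unfolding eq by (rule C.glued_metric_chart[OF pc])
  qed
qed

lemma metric_pos_zero:
  assumes "positively_curved (O1_PV sc :: ('v set, 'v set, 'd, unit) hol_bundle) h"
    "P \<in> hyperplanes sc" "q \<in> quot P"
  shows "h (P, P) = 0" "q \<noteq> P \<Longrightarrow> h (P, q) > 0"
proof -
  obtain b' :: "'d option \<Rightarrow> 'v" and w where b': "is_basis sc b'" "P = chart_hyperplane sc b' w"
    using hyperplane_chart[OF assms(2)] .
  interpret C: basis_chart sc b' by unfold_locales (rule b'(1))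
  note wt = C.chart_weight(1,2)[OF assms(1), of w]
  show "h (P, P) = 0" using wt(1)[of 0] by (simp add: b'(2) C.chart_coset_0)
  show "h (P, q) > 0" if "q \<noteq> P"
  proof -
    obtain t where t: "q = chart_coset sc b' w t"
      using assms(3) C.chart_coset_bij[of w] by (auto simp: b'(2) bij_betw_def)
    then have "t \<noteq> 0" using that b'(2) C.chart_coset_0 by metis
    then have "cmod (t $ ()) > 0" by (simp add: complex_vec_unit_eq_0)
    then show ?thesis using wt(1)[of t] wt(2) by (simp add: t b'(2))
  qed
qed

end

theorem lemma4p2:
  fixes sc :: "complex \<Rightarrow> 'v::ab_group_add \<Rightarrow> 'v"
    and r :: nat
    and \<kappa> :: "nat \<Rightarrow> 'v set \<times> 'v set \<Rightarrow> real"
  assumes "vector_space sc"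
    and "vector_space.dim sc (UNIV :: 'v set) = r"
    and "r \<ge> 2"
    and "CARD('d::finite) = r - 1"
    and "\<And>j. j \<in> {1, 2, 3} \<Longrightarrow>
           positively_curved (O1_PV sc :: ('v set, 'v set, 'd, unit) hol_bundle) (\<kappa> j)"
    and "\<And>P q. P \<in> hyperplanes sc \<Longrightarrow> q \<in> quot P \<Longrightarrow> q \<noteq> P \<Longrightarrow>
           \<kappa> 1 (P, q) > \<kappa> 2 (P, q) \<and> \<kappa> 2 (P, q) > \<kappa> 3 (P, q)"
  shows "\<exists>(\<rho> :: nat \<Rightarrow> real) (k :: ((complex^'m::finite) \<times> 'v set) \<times> 'v set \<Rightarrow> real).
      0 < \<rho> 1 \<and> \<rho> 1 < \<rho> 2 \<and> \<rho> 2 < \<rho> 3 \<and> \<rho> 3 < 1 \<and>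
      positively_curved
        (O1_PF (ball 0 1) sc :: ((complex^'m) \<times> 'v set, 'v set, 'm + 'd, unit) hol_bundle) k \<and>
      (\<forall>j\<in>{1, 2, 3}.
         (\<forall>s\<in>ball 0 1. norm s = \<rho> j \<longrightarrow>
            (\<forall>P\<in>hyperplanes sc. \<forall>q\<in>quot P. k ((s, P), q) = \<kappa> j (P, q))) \<and>
         (\<exists>\<epsilon>>0. \<forall>s\<in>ball 0 1. \<bar>norm s - \<rho> j\<bar> < \<epsilon> \<longrightarrow>
            (\<exists>c>0. \<forall>P\<in>hyperplanes sc. \<forall>q\<in>quot P. k ((s, P), q) = c * \<kappa> j (P, q))))"
proof -
  interpret vector_space sc by (rule assms(1))
  obtain b :: "'d option \<Rightarrow> 'v" where "is_basis sc b"
    using exists_basis[where 'd = 'd] assms(2-4) by (auto simp: is_basis_def)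
  then interpret basis_chart sc b by unfold_locales
  note pc = assms(5)
  have "\<exists>\<delta>>0. \<exists>M. \<forall>P\<in>hyperplanes sc. \<forall>q\<in>quot P. q \<noteq> P \<longrightarrow>
      \<delta> \<le> ln (\<kappa> 1 (P, q)) - ln (\<kappa> 2 (P, q)) \<and> ln (\<kappa> 1 (P, q)) - ln (\<kappa> 2 (P, q)) \<le> M"
    by (rule ln_ratio_bounds[OF pc pc]) (use assms(6) in auto)
  then obtain \<delta>1 M1 where 1: "\<delta>1 > 0" "\<And>P q. P \<in> hyperplanes sc \<Longrightarrow> q \<in> quot P \<Longrightarrow> q \<noteq> P \<Longrightarrow>
      \<delta>1 \<le> ln (\<kappa> 1 (P, q)) - ln (\<kappa> 2 (P, q)) \<and> ln (\<kappa> 1 (P, q)) - ln (\<kappa> 2 (P, q)) \<le> M1"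
    by blast
  have "\<exists>\<delta>>0. \<exists>M. \<forall>P\<in>hyperplanes sc. \<forall>q\<in>quot P. q \<noteq> P \<longrightarrow>
      \<delta> \<le> ln (\<kappa> 2 (P, q)) - ln (\<kappa> 3 (P, q)) \<and> ln (\<kappa> 2 (P, q)) - ln (\<kappa> 3 (P, q)) \<le> M"
    by (rule ln_ratio_bounds[OF pc pc]) (use assms(6) in auto)
  then obtain \<delta>2 M2 where 2: "\<delta>2 > 0" "\<And>P q. P \<in> hyperplanes sc \<Longrightarrow> q \<in> quot P \<Longrightarrow> q \<noteq> P \<Longrightarrow>
      \<delta>2 \<le> ln (\<kappa> 2 (P, q)) - ln (\<kappa> 3 (P, q)) \<and> ln (\<kappa> 2 (P, q)) - ln (\<kappa> 3 (P, q)) \<le> M2"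
    by blast
  define \<delta> M where "\<delta> = min \<delta>1 \<delta>2" and "M = max M1 M2"
  have \<delta>: "\<delta> > 0" using 1(1) 2(1) by (simp add: \<delta>_def)
  obtain A \<sigma> :: "nat \<Rightarrow> real" and \<nu> where \<nu>: "\<nu> > 0" and A: "\<And>j. j \<in> {1, 2, 3} \<Longrightarrow> A j > 0"
    and \<sigma>: "0 < \<sigma> 1" "\<sigma> 1 < \<sigma> 2" "\<sigma> 2 < \<sigma> 3" "\<sigma> 3 < 1"
    and sep: "\<And>\<phi> x. \<delta> \<le> \<phi> 2 - \<phi> 1 \<and> \<phi> 2 - \<phi> 1 \<le> M \<and> \<delta> \<le> \<phi> 3 - \<phi> 2 \<and> \<phi> 3 - \<phi> 2 \<le> M \<Longrightarrow>
      (let \<psi> = (\<lambda>j :: nat. \<phi> j + A j * (x - \<sigma> j)) in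
       (\<bar>x - \<sigma> 1\<bar> < \<nu> \<longrightarrow> \<psi> 1 - \<psi> 2 \<ge> \<delta> / 4 \<and> \<psi> 2 - \<psi> 3 \<ge> \<delta> / 4) \<and>
       (\<bar>x - \<sigma> 2\<bar> < \<nu> \<longrightarrow> \<psi> 2 - \<psi> 1 \<ge> \<delta> / 4 \<and> \<psi> 2 - \<psi> 3 \<ge> \<delta> / 4) \<and>
       (\<bar>x - \<sigma> 3\<bar> < \<nu> \<longrightarrow> \<psi> 2 - \<psi> 1 \<ge> \<delta> / 4 \<and> \<psi> 3 - \<psi> 2 \<ge> \<delta> / 4))"
    using exists_gluing_constants[OF \<delta>, of M] by metis
  obtain \<theta> \<theta>1 \<theta>2 :: "real \<Rightarrow> real" where \<theta>: "smooth_on UNIV \<theta>"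
    "\<And>x. (\<theta> has_real_derivative \<theta>1 x) (at x)" "\<And>x. (\<theta>1 has_real_derivative \<theta>2 x) (at x)"
    "\<And>x. 0 \<le> \<theta>1 x \<and> \<theta>1 x \<le> 1 \<and> 0 \<le> \<theta>2 x"
    and low: "\<And>x. x \<le> - (\<delta> / 4) \<Longrightarrow> \<theta> x = 0" and high: "\<And>x. x \<ge> \<delta> / 4 \<Longrightarrow> \<theta> x = x"
    using exists_regularized_pos_part[of "\<delta> / 4"] \<delta> by auto
  have left: "reg_max \<theta> f g = f" if "f - g \<ge> \<delta> / 4" for f g
    using high[OF that] by (simp add: reg_max_def)
  have right: "reg_max \<theta> f g = g" if "g - f \<ge> \<delta> / 4" for f g
    using low[of "f - g"] that by (simp add: reg_max_def)
  let ?k = "glued_metric \<theta> A \<sigma> \<kappa> :: ((complex^'m) \<times> 'v set) \<times> 'v set \<Rightarrow> real"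
  have near: "?k ((s, P), q) = exp (- A j * ((norm s)\<^sup>2 - \<sigma> j)) * \<kappa> j (P, q)"
    if j: "j \<in> {1, 2, 3}" and s: "\<bar>(norm s)\<^sup>2 - \<sigma> j\<bar> < \<nu>" and P: "P \<in> hyperplanes sc" "q \<in> quot P" for j s P q
  proof (cases "q = P")
    case True
    then show ?thesis using metric_pos_zero(1)[OF pc[OF j] P] by (simp add: glued_metric_def)
  next
    case False
    let ?\<phi> = "\<lambda>j. - ln (\<kappa> j (P, q))"
    let ?\<psi> = "\<lambda>j. ?\<phi> j + A j * ((norm s)\<^sup>2 - \<sigma> j)"
    have "\<delta> \<le> ?\<phi> 2 - ?\<phi> 1 \<and> ?\<phi> 2 - ?\<phi> 1 \<le> M \<and> \<delta> \<le> ?\<phi> 3 - ?\<phi> 2 \<and> ?\<phi> 3 - ?\<phi> 2 \<le> M"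
      using 1(2)[OF P False] 2(2)[OF P False] by (auto simp: \<delta>_def M_def)
    note sep' = sep[OF this, of "(norm s)\<^sup>2", unfolded Let_def]
    consider "j = 1" | "j = 2" | "j = 3" using j by auto
    then have "glued_weight \<theta> A \<sigma> ?\<phi> ((norm s)\<^sup>2) = ?\<psi> j"
    proof cases
      case 1
      then have d: "?\<psi> 1 - ?\<psi> 2 \<ge> \<delta> / 4" "?\<psi> 2 - ?\<psi> 3 \<ge> \<delta> / 4" using sep' s by auto
      then have "?\<psi> 1 - ?\<psi> 3 \<ge> \<delta> / 4" using \<delta> by linarith
      then show ?thesis unfolding glued_weight_def left[OF d(1)] 1 by (rule left)
    next
      case 2
      then have d: "?\<psi> 2 - ?\<psi> 1 \<ge> \<delta> / 4" "?\<psi> 2 - ?\<psi> 3 \<ge> \<delta> / 4" using sep' s by auto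
      then show ?thesis unfolding glued_weight_def right[OF d(1)] 2 by (intro left)
    next
      case 3
      then have d: "?\<psi> 2 - ?\<psi> 1 \<ge> \<delta> / 4" "?\<psi> 3 - ?\<psi> 2 \<ge> \<delta> / 4" using sep' s by auto
      then show ?thesis unfolding glued_weight_def right[OF d(1)] 3 by (intro right)
    qed
    then have "- glued_weight \<theta> A \<sigma> ?\<phi> ((norm s)\<^sup>2) = - A j * ((norm s)\<^sup>2 - \<sigma> j) + ln (\<kappa> j (P, q))"
      by simp
    then have "?k ((s, P), q) = exp (- A j * ((norm s)\<^sup>2 - \<sigma> j) + ln (\<kappa> j (P, q)))"
      using False by (simp add: glued_metric_def)
    then show ?thesis
      using metric_pos_zero(2)[OF pc[OF j] P False] by (simp only: exp_add exp_ln)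
  qed
  have pos: "0 < \<sigma> j \<and> \<sigma> j < 1" if "j \<in> {1, 2, 3}" for j using that \<sigma> by auto
  show ?thesis
  proof (intro exI[of _ "\<lambda>j. sqrt (\<sigma> j)"] exI[of _ ?k] conjI ballI)
    show "0 < sqrt (\<sigma> 1)" "sqrt (\<sigma> 1) < sqrt (\<sigma> 2)" "sqrt (\<sigma> 2) < sqrt (\<sigma> 3)" "sqrt (\<sigma> 3) < 1"
      using \<sigma> by simp_all
    show "positively_curved (O1_PF (ball 0 1) sc :: ((complex^'m) \<times> 'v set, 'v set, 'm + 'd, unit) hol_bundle) ?k"
      by (rule positively_curved_glued_metric[OF pc \<theta> A open_ball])
    fix j :: nat assume j: "j \<in> {1, 2, 3}"
    show "norm s = sqrt (\<sigma> j) \<longrightarrow> (\<forall>P\<in>hyperplanes sc. \<forall>q\<in>quot P. ?k ((s, P), q) = \<kappa> j (P, q))"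
      for s :: "complex^'m"
    proof (intro ballI impI)
      fix P q
      assume "norm s = sqrt (\<sigma> j)" and P: "P \<in> hyperplanes sc" "q \<in> quot P"
      then have "(norm s)\<^sup>2 = \<sigma> j" using pos[OF j] by simp
      then show "?k ((s, P), q) = \<kappa> j (P, q)" using near[OF j _ P, of s] \<nu> by simp
    qed
    show "\<exists>\<epsilon>>0. \<forall>s\<in>ball 0 1. \<bar>norm s - sqrt (\<sigma> j)\<bar> < \<epsilon> \<longrightarrow>
        (\<exists>c>0. \<forall>P\<in>hyperplanes sc. \<forall>q\<in>quot P. ?k ((s, P), q) = c * \<kappa> j (P, q))"
    proof (rule exI[of _ "\<nu> / 2"], intro conjI ballI impI)
      show "\<nu> / 2 > 0" using \<nu> by simp
      fix s :: "complex^'m" assume s: "s \<in> ball 0 1" "\<bar>norm s - sqrt (\<sigma> j)\<bar> < \<nu> / 2"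
      have lt: "norm s + sqrt (\<sigma> j) < 2" "norm s + sqrt (\<sigma> j) > 0"
      proof -
        have "norm s < 1" "0 < sqrt (\<sigma> j)" "sqrt (\<sigma> j) < 1" using s(1) pos[OF j] by simp_all
        then show "norm s + sqrt (\<sigma> j) < 2" "norm s + sqrt (\<sigma> j) > 0"
          using norm_ge_zero[of s] by linarith+
      qed
      have "(norm s)\<^sup>2 - \<sigma> j = (norm s - sqrt (\<sigma> j)) * (norm s + sqrt (\<sigma> j))"
        using pos[OF j] by (simp add: power2_eq_square algebra_simps)
      then have "\<bar>(norm s)\<^sup>2 - \<sigma> j\<bar> = \<bar>norm s - sqrt (\<sigma> j)\<bar> * (norm s + sqrt (\<sigma> j))"
        using lt by (simp add: abs_mult)
      also have "\<dots> < \<nu> / 2 * 2"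
        using s(2) lt by (intro mult_strict_mono') auto
      finally have "\<bar>(norm s)\<^sup>2 - \<sigma> j\<bar> < \<nu>" by simp
      from near[OF j this]
      show "\<exists>c>0. \<forall>P\<in>hyperplanes sc. \<forall>q\<in>quot P. ?k ((s, P), q) = c * \<kappa> j (P, q)"
        by (intro exI[of _ "exp (- A j * ((norm s)\<^sup>2 - \<sigma> j))"]) simp
    qed
  qed
qed

end
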